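(* Let $\hat J\in[0,+\infty)$. For each positive integer $N$ let $(Y_k)_{k\ge1}=(Y_k^{(N)})_{k\ge1}$ be the Wolff dynamics on $\{-1,+1\}^N$ with coupling constant $\hat J$, started from any initial configuration, all defined on a probability space with measure $\mathbb P$, and for $M\ge1$ let $\mathbb K=\mathbb K^{(N,M)}$ be the $N\times N$ sample covariance matrix $$\mathbb K=\frac1{MN}\sum_{k=1}^MY_kY_k^T.$$ Then $$\mathbb P\Big(\lim_{N\to+\infty}\lim_{M\to+\infty}\rho(\mathbb K)=0\Big)=\mathbb P\Big(\lim_{N\to+\infty}\lim_{M\to+\infty}\|\mathbb K\|_1=0\Big)=1,$$ where $\rho(\mathbb K)$ is the spectral radius and $\|\mathbb K\|_1=\max_{1\le i\le N}\sum_{j=1}^N|\mathbb K_{ij}|$. Furthermore, the largest eigenvalue $\lambda_1(\mathbb K)$ satisfies $$\lim_{N\to+\infty}\lim_{M\to+\infty}\lambda_1(\mathbb K)=0,\qquad\mathbb P\text{-a.s.}$$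
   Context: $G=([N],\mathcal G)$ is the undirected cycle on $[N]=\{1,\dots,N\}$ with the $N$ edges $\{i,i+1\}$, $i=1,\dots,N$, indices cyclic ($N+1\equiv1$; edges counted with multiplicity if $N=2$). Wolff dynamics: a Markov chain on $\Omega=\{-1,+1\}^N$; one step from $\sigma\in\Omega$ is as follows. Choose a site $i_0\in[N]$ uniformly at random and start the cluster with $i_0$. Repeatedly, for each site $i$ in the cluster and each edge joining $i$ to a neighbour $j$ with $\sigma_j=\sigma_i$ such that this edge has not been considered before, add $j$ to the cluster with probability $1-e^{-\hat J(1+\sigma_i\sigma_j)}=1-e^{-2\hat J}$, independently over edges. When no edge remains to be considered, flip all spins of the cluster (with probability 1). Equivalently: declare each edge with aligned endpoint spins open independently with probability $1-e^{-2\hat J}$ (all other edges are closed), and flip the open-connected component of $i_0$. Its invariant measure is the Ising Gibbs measure $\mu_N(\sigma)=Z_N^{-1}\exp\big(\hat J\sum_{i=1}^N\sigma_i\sigma_{i+1}\big)$. In the paper $\mathbb K=\frac1M\mathbb X\mathbb X^T$, where $\mathbb X=(X_1,\dots,X_M)$ is the $N\times M$ matrix with columns $X_k=Y_k/\sqrt N$; this is the matrix displayed in the claim. *)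

theory Defs
  imports "HOL-Probability.Probability" "HOL-Probability.Product_PMF"
    "Jordan_Normal_Form.Spectral_Radius"
begin

text \<open>
  The sites \<open>1, \<dots>, N\<close> of the cycle are represented by \<open>0, \<dots>, N - 1\<close>, matching the
  index convention of \<^theory>\<open>Jordan_Normal_Form.Matrix\<close>.
\<close>

definition spin_configs :: "nat \<Rightarrow> (nat \<Rightarrow> real) set" where
  "spin_configs N = {..<N} \<rightarrow>\<^sub>E {-1, 1}"

text \<open>
  The edges of the cycle are indexed by \<open>e < N\<close>, edge \<open>e\<close> joining \<open>e\<close> and \<open>(e + 1) mod N\<close>; for
  \<open>N = 2\<close> this gives two parallel edges and for \<open>N = 1\<close> a loop. A predicate \<open>op\<close> on edge indices
  selects the open edges.
\<close>

definition open_adjacency :: "nat \<Rightarrow> (nat \<Rightarrow> bool) \<Rightarrow> (nat \<times> nat) set" where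
  "open_adjacency N op = {(i, j). \<exists>e<N. op e \<and> {i, j} = {e, Suc e mod N}}"

definition open_cluster :: "nat \<Rightarrow> (nat \<Rightarrow> bool) \<Rightarrow> nat \<Rightarrow> nat set" where
  "open_cluster N op i\<^sub>0 = {j. (i\<^sub>0, j) \<in> (open_adjacency N op)\<^sup>*}"

definition flip_spins :: "nat set \<Rightarrow> (nat \<Rightarrow> real) \<Rightarrow> nat \<Rightarrow> real" where
  "flip_spins C \<sigma> = (\<lambda>i. if i \<in> C then - \<sigma> i else \<sigma> i)"

text \<open>
  An edge is open with probability \<open>1 - exp (- J * (1 + \<sigma> i * \<sigma> j))\<close>, which is
  \<open>1 - exp (- 2 * J)\<close> if its endpoint spins are aligned and \<open>0\<close> otherwise.
\<close>

definition wolff_step :: "real \<Rightarrow> nat \<Rightarrow> (nat \<Rightarrow> real) \<Rightarrow> (nat \<Rightarrow> real) pmf" where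
  "wolff_step J N \<sigma> =
     bind_pmf (pmf_of_set {..<N}) (\<lambda>i\<^sub>0.
     bind_pmf (Pi_pmf {..<N} False
        (\<lambda>e. bernoulli_pmf (1 - exp (- J * (1 + \<sigma> e * \<sigma> (Suc e mod N)))))) (\<lambda>op.
     return_pmf (flip_spins (open_cluster N op i\<^sub>0) \<sigma>)))"

text \<open>
  Time starts at 1, and the law of the initial state \<open>Y 1\<close> is arbitrary. The Markov property is
  stated without division, so that it is also meaningful for histories of probability 0.
\<close>

definition markov_chain ::
    "'w measure \<Rightarrow> 's set \<Rightarrow> ('s \<Rightarrow> 's pmf) \<Rightarrow> (nat \<Rightarrow> 'w \<Rightarrow> 's) \<Rightarrow> bool" where
  "markov_chain P S p Y \<longleftrightarrow>
     (\<forall>k\<ge>1. Y k \<in> P \<rightarrow>\<^sub>M count_space S) \<and>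
     (\<forall>n\<ge>1. \<forall>s. (\<forall>k\<in>{1..Suc n}. s k \<in> S) \<longrightarrow>
        measure P {w \<in> space P. \<forall>k\<in>{1..Suc n}. Y k w = s k} =
        measure P {w \<in> space P. \<forall>k\<in>{1..n}. Y k w = s k} * pmf (p (s n)) (s (Suc n)))"

definition wolff_dynamics ::
    "'w measure \<Rightarrow> real \<Rightarrow> nat \<Rightarrow> (nat \<Rightarrow> 'w \<Rightarrow> nat \<Rightarrow> real) \<Rightarrow> bool" where
  "wolff_dynamics P J N Y \<longleftrightarrow> markov_chain P (spin_configs N) (wolff_step J N) Y"

definition sample_cov :: "nat \<Rightarrow> nat \<Rightarrow> (nat \<Rightarrow> nat \<Rightarrow> real) \<Rightarrow> real mat" where
  "sample_cov N M y =
     Matrix.mat N N (\<lambda>(i, j). 1 / (real M * real N) * (\<Sum>k=1..M. y k i * y k j))"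

definition row_sum_norm :: "real mat \<Rightarrow> real" where
  "row_sum_norm A = Max ((\<lambda>i. \<Sum>j<dim_col A. \<bar>A $$ (i, j)\<bar>) ` {..<dim_row A})"

definition real_spectral_radius :: "real mat \<Rightarrow> real" where
  "real_spectral_radius A = spectral_radius (map_mat complex_of_real A)"

text \<open>
  Intended for real symmetric matrices of positive dimension, all of whose eigenvalues are real.
\<close>

definition largest_eigenvalue :: "real mat \<Rightarrow> real" where
  "largest_eigenvalue A = Max (spectrum A)"

text \<open>
  The iterated limit includes the existence of the inner limit for every \<open>N \<ge> 1\<close>.
\<close>

definition iterated_limit :: "(nat \<Rightarrow> nat \<Rightarrow> real) \<Rightarrow> real \<Rightarrow> bool" where
  "iterated_limit a l \<longleftrightarrow>
     (\<exists>L. (\<forall>N\<ge>1. (\<lambda>M. a N M) \<longlonglongrightarrow> L N) \<and> L \<longlonglongrightarrow> l)"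

end

theory Submission
  imports Defs "HOL-Library.Discrete_Functions"
begin

text \<open>
  For fixed \<open>N\<close>, the Wolff dynamics is an irreducible Markov chain on a finite set, with invariant
  law the Ising Gibbs measure. By the ergodic theorem the matrix \<open>K\<close> converges almost surely, as
  \<open>M \<rightarrow> \<infinity>\<close>, to \<open>1 / N\<close> times the matrix of Ising correlations
  \<open>\<langle>\<sigma>\<^sub>i \<sigma>\<^sub>j\<rangle>\<close>. In one dimension these correlations decay exponentially, at rate
  \<open>tanh J < 1\<close>, so the rows of the correlation matrix have absolute sums bounded uniformly in
  \<open>N\<close>, and the factor \<open>1 / N\<close> makes the limit matrix vanish in row sum norm as
  \<open>N \<rightarrow> \<infinity>\<close>.

  The spectral quantities follow from the row sum norm. All matrices involved are symmetric positive
  semidefinite, so the largest eigenvalue and the spectral radius coincide. The latter is at most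
  the row sum norm and is 1-Lipschitz with respect to it (\<open>spectral_radius_diff_le\<close>),
  which gives the existence of the inner limits.

  The Wolff chain can be periodic (for \<open>J = 0\<close> it flips one spin at every step), so its laws need
  not converge, and the ergodic theorem (\<open>ergodic_theorem\<close>) is proved without a
  convergence theorem for the laws. The innovations
  \<open>1[Y\<^sub>k\<^sub>+\<^sub>1 = t] - p (Y\<^sub>k, t)\<close> are bounded and orthogonal, hence satisfy a strong law of
  large numbers. Therefore the occupation measures are asymptotically invariant, and by compactness
  and uniqueness of the invariant law they converge to it.

  Invariance of the Gibbs measure (\<open>ising_gibbs_invariant\<close>) is seen for each starting
  site and each configuration of open edges separately: flipping the cluster is then an involution
  that preserves the product of the Gibbs weight of the spins and the probability of the edges.
  The correlations (\<open>ising_corr_eq\<close>) come from summing out the spins one at a time.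
\<close>

section \<open>Spectral radius and quadratic forms of positive semidefinite matrices\<close>

text \<open>
  Test vectors are plain functions of the index, of which only the values at indices below the
  dimension matter; this keeps double sums free of carrier conditions.
\<close>

definition quad_form :: "real mat \<Rightarrow> (nat \<Rightarrow> real) \<Rightarrow> real" where
  "quad_form A x = (\<Sum>i<dim_row A. \<Sum>j<dim_row A. x i * A $$ (i, j) * x j)"

definition psd_mat :: "nat \<Rightarrow> real mat \<Rightarrow> bool" where
  "psd_mat n A \<longleftrightarrow> A \<in> carrier_mat n n \<and> transpose_mat A = A \<and> (\<forall>x. 0 \<le> quad_form A x)"

lemma symmetric_mat_index:
  assumes "A \<in> carrier_mat n n" "transpose_mat A = A" "i < n" "j < n"
  shows "A $$ (i, j) = A $$ (j, i)"
  using assms index_transpose_mat(1)[of i A j] by auto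

lemma row_sum_le_row_sum_norm:
  assumes "A \<in> carrier_mat n n" "i < n"
  shows "(\<Sum>j<n. \<bar>A $$ (i, j)\<bar>) \<le> row_sum_norm A"
  unfolding row_sum_norm_def using assms by (auto intro!: Max_ge)

lemma row_sum_norm_le:
  assumes "A \<in> carrier_mat n n" "n > 0" "\<And>i. i < n \<Longrightarrow> (\<Sum>j<n. \<bar>A $$ (i, j)\<bar>) \<le> c"
  shows "row_sum_norm A \<le> c"
  unfolding row_sum_norm_def using assms by (auto intro!: Max.boundedI)

lemma row_sum_norm_nonneg:
  assumes "A \<in> carrier_mat n n" "n > 0"
  shows "row_sum_norm A \<ge> 0"
  using row_sum_le_row_sum_norm[OF assms] by (rule order_trans[rotated]) (simp add: sum_nonneg)

lemma row_sum_norm_triangle: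
  assumes A: "A \<in> carrier_mat n n" and B: "B \<in> carrier_mat n n" and n: "n > 0"
  shows "row_sum_norm A \<le> row_sum_norm B + row_sum_norm (A - B)"
proof (rule row_sum_norm_le[OF A n])
  fix i assume i: "i < n"
  have "(\<Sum>j<n. \<bar>A $$ (i, j)\<bar>) \<le> (\<Sum>j<n. \<bar>B $$ (i, j)\<bar> + \<bar>(A - B) $$ (i, j)\<bar>)"
    using A B i by (intro sum_mono) auto
  also have "\<dots> = (\<Sum>j<n. \<bar>B $$ (i, j)\<bar>) + (\<Sum>j<n. \<bar>(A - B) $$ (i, j)\<bar>)"
    by (rule sum.distrib)
  also have "\<dots> \<le> row_sum_norm B + row_sum_norm (A - B)"
    using A B i by (intro add_mono row_sum_le_row_sum_norm[where n = n]) auto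
  finally show "(\<Sum>j<n. \<bar>A $$ (i, j)\<bar>) \<le> row_sum_norm B + row_sum_norm (A - B)" .
qed

lemma row_sum_norm_minus_commute:
  assumes "A \<in> carrier_mat n n" "B \<in> carrier_mat n n"
  shows "row_sum_norm (A - B) = row_sum_norm (B - A)"
  unfolding row_sum_norm_def using assms
  by (auto intro!: arg_cong[of _ _ Max] image_cong sum.cong simp: abs_minus_commute)

lemma row_sum_norm_diff_le:
  assumes A: "A \<in> carrier_mat n n" and B: "B \<in> carrier_mat n n" and n: "n > 0"
  shows "\<bar>row_sum_norm A - row_sum_norm B\<bar> \<le> row_sum_norm (A - B)"
  using row_sum_norm_triangle[OF A B n] row_sum_norm_triangle[OF B A n]
    row_sum_norm_minus_commute[OF A B] by linarith

lemma row_sum_norm_tendsto_0: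
  assumes A: "\<And>m. A m \<in> carrier_mat n n" and B: "B \<in> carrier_mat n n" and n: "n > 0"
    and lim: "\<And>i j. i < n \<Longrightarrow> j < n \<Longrightarrow> (\<lambda>m. A m $$ (i, j)) \<longlonglongrightarrow> B $$ (i, j)"
  shows "(\<lambda>m. row_sum_norm (A m - B)) \<longlonglongrightarrow> 0"
proof (rule Lim_null_comparison)
  let ?e = "\<lambda>m. \<Sum>i<n. \<Sum>j<n. \<bar>(A m - B) $$ (i, j)\<bar>"
  have D: "A m - B \<in> carrier_mat n n" for m by (rule minus_carrier_mat[OF B])
  show "\<forall>\<^sub>F m in sequentially. norm (row_sum_norm (A m - B)) \<le> ?e m"
  proof (intro always_eventually allI)
    fix m
    have "row_sum_norm (A m - B) \<le> ?e m"
    proof (rule row_sum_norm_le[OF D n])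
      fix i assume "i < n"
      then show "(\<Sum>j<n. \<bar>(A m - B) $$ (i, j)\<bar>) \<le> ?e m"
        by (intro member_le_sum[of i "{..<n}" "\<lambda>i. \<Sum>j<n. \<bar>(A m - B) $$ (i, j)\<bar>"])
          (auto intro: sum_nonneg)
    qed
    then show "norm (row_sum_norm (A m - B)) \<le> ?e m"
      using row_sum_norm_nonneg[OF D n] by simp
  qed
  have "(\<lambda>m. \<Sum>i<n. \<Sum>j<n. \<bar>A m $$ (i, j) - B $$ (i, j)\<bar>)
      \<longlonglongrightarrow> (\<Sum>i<n. \<Sum>j<n. \<bar>B $$ (i, j) - B $$ (i, j)\<bar>)"
    by (intro tendsto_sum tendsto_rabs tendsto_diff tendsto_const lim) auto
  moreover have "?e m = (\<Sum>i<n. \<Sum>j<n. \<bar>A m $$ (i, j) - B $$ (i, j)\<bar>)" for m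
    using B by (intro sum.cong) auto
  ultimately show "?e \<longlonglongrightarrow> 0" by simp
qed

text \<open>
  Schur's test: apply \<open>2 \<bar>x\<^sub>i x\<^sub>j\<bar> \<le> x\<^sub>i\<^sup>2 + x\<^sub>j\<^sup>2\<close>; by symmetry both halves
  are sums of \<open>x\<^sub>i\<^sup>2\<close> weighted by the absolute row sums.
\<close>

lemma quad_form_le_row_sum_norm:
  assumes A: "A \<in> carrier_mat n n" and sym: "transpose_mat A = A"
  shows "quad_form A x \<le> row_sum_norm A * (\<Sum>i<n. (x i)\<^sup>2)"
proof -
  have dim: "dim_row A = n" using A by auto
  have "quad_form A x \<le> (\<Sum>i<n. \<Sum>j<n. \<bar>A $$ (i, j)\<bar> * ((x i)\<^sup>2 + (x j)\<^sup>2) / 2)"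
    unfolding quad_form_def dim
  proof (intro sum_mono)
    fix i j
    have "x i * A $$ (i, j) * x j \<le> \<bar>A $$ (i, j)\<bar> * \<bar>x i * x j\<bar>"
      using abs_ge_self[of "x i * A $$ (i, j) * x j"] by (simp add: abs_mult mult_ac)
    also have "\<bar>x i * x j\<bar> \<le> ((x i)\<^sup>2 + (x j)\<^sup>2) / 2"
      using sum_squares_bound[of "\<bar>x i\<bar>" "\<bar>x j\<bar>"] by (simp add: abs_mult)
    finally show "x i * A $$ (i, j) * x j \<le> \<bar>A $$ (i, j)\<bar> * ((x i)\<^sup>2 + (x j)\<^sup>2) / 2"
      by (simp add: mult_left_mono)
  qed
  also have "\<dots> = (\<Sum>i<n. \<Sum>j<n. \<bar>A $$ (i, j)\<bar> * (x i)\<^sup>2) / 2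
      + (\<Sum>i<n. \<Sum>j<n. \<bar>A $$ (i, j)\<bar> * (x j)\<^sup>2) / 2"
    by (simp add: sum.distrib sum_divide_distrib add_divide_distrib distrib_left)
  also have "(\<Sum>i<n. \<Sum>j<n. \<bar>A $$ (i, j)\<bar> * (x j)\<^sup>2)
      = (\<Sum>i<n. \<Sum>j<n. \<bar>A $$ (i, j)\<bar> * (x i)\<^sup>2)"
    by (subst sum.swap) (auto intro!: sum.cong simp: symmetric_mat_index[OF A sym])
  also have "(\<Sum>i<n. \<Sum>j<n. \<bar>A $$ (i, j)\<bar> * (x i)\<^sup>2)
      = (\<Sum>i<n. (\<Sum>j<n. \<bar>A $$ (i, j)\<bar>) * (x i)\<^sup>2)"
    by (simp add: sum_distrib_right)
  also have "\<dots> \<le> (\<Sum>i<n. row_sum_norm A * (x i)\<^sup>2)"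
    by (intro sum_mono mult_right_mono row_sum_le_row_sum_norm[OF A]) auto
  finally show ?thesis by (simp add: sum_distrib_left)
qed

lemma quad_form_diff:
  assumes "A \<in> carrier_mat n n" "B \<in> carrier_mat n n"
  shows "quad_form (A - B) x = quad_form A x - quad_form B x"
  using assms by (simp add: quad_form_def sum_subtractf[symmetric] algebra_simps)

lemma eigenvalue_imp_quad_form:
  assumes A: "A \<in> carrier_mat n n" and ev: "eigenvalue A l"
  obtains x where "(\<Sum>i<n. (x i)\<^sup>2) > 0" "quad_form A x = l * (\<Sum>i<n. (x i)\<^sup>2)"
proof -
  from ev obtain v where v: "v \<in> carrier_vec n" "v \<noteq> 0\<^sub>v n" and Av: "A *\<^sub>v v = l \<cdot>\<^sub>v v"
    using A unfolding eigenvalue_def eigenvector_def by auto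
  have row: "(\<Sum>j<n. A $$ (i, j) * v $ j) = l * v $ i" if "i < n" for i
  proof -
    have "(A *\<^sub>v v) $ i = l * v $ i" using Av v that by simp
    then show ?thesis using A v that by (simp add: scalar_prod_def atLeast0LessThan)
  qed
  obtain i where "i < n" "v $ i \<noteq> 0" using v by (metis eq_vecI carrier_vecD index_zero_vec)
  then have pos: "(\<Sum>i<n. (v $ i)\<^sup>2) > 0"
    by (intro sum_pos2[of _ i]) auto
  have "quad_form A (($) v) = (\<Sum>i<n. v $ i * (\<Sum>j<n. A $$ (i, j) * v $ j))"
    using A by (simp add: quad_form_def sum_distrib_left mult.assoc)
  also have "\<dots> = (\<Sum>i<n. l * (v $ i)\<^sup>2)"
    by (intro sum.cong refl) (simp add: row power2_eq_square)
  finally have "quad_form A (($) v) = l * (\<Sum>i<n. (v $ i)\<^sup>2)"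
    by (simp add: sum_distrib_left)
  then show ?thesis by (rule that[OF pos])
qed

text \<open>
  With a complex eigenvector \<open>v\<close>, the number \<open>v\<^sup>* A v = z \<cdot> \<bar>v\<bar>\<^sup>2\<close> equals its own conjugate, so
  \<open>z\<close> is real; being a root of the characteristic polynomial, whose coefficients are real, it is an
  eigenvalue over the reals.
\<close>

lemma symmetric_complex_eigenvalue:
  assumes A: "A \<in> carrier_mat n n" and sym: "transpose_mat A = A"
    and ev: "eigenvalue (map_mat complex_of_real A) z"
  obtains l where "z = complex_of_real l" "eigenvalue A l"
proof -
  let ?A = "map_mat complex_of_real A"
  have cA: "?A \<in> carrier_mat n n" using A by simp
  from ev obtain v where v: "v \<in> carrier_vec n" "v \<noteq> 0\<^sub>v n" and Av: "?A *\<^sub>v v = z \<cdot>\<^sub>v v"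
    using A unfolding eigenvalue_def eigenvector_def by auto
  have row: "(\<Sum>j<n. complex_of_real (A $$ (i, j)) * v $ j) = z * v $ i" if "i < n" for i
  proof -
    have "(?A *\<^sub>v v) $ i = z * v $ i" using Av v that by simp
    then show ?thesis using A v that by (simp add: scalar_prod_def atLeast0LessThan)
  qed
  define s where "s = (\<Sum>i<n. (cmod (v $ i))\<^sup>2)"
  define q where "q = (\<Sum>i<n. \<Sum>j<n. cnj (v $ i) * complex_of_real (A $$ (i, j)) * v $ j)"
  have "q = (\<Sum>i<n. cnj (v $ i) * (\<Sum>j<n. complex_of_real (A $$ (i, j)) * v $ j))"
    by (simp add: q_def sum_distrib_left mult.assoc)
  also have "\<dots> = (\<Sum>i<n. z * complex_of_real ((cmod (v $ i))\<^sup>2))"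
    by (intro sum.cong refl) (simp add: row complex_norm_square del: of_real_power)
  also have "\<dots> = z * complex_of_real s"
    by (simp add: s_def sum_distrib_left)
  finally have q: "q = z * complex_of_real s" .
  have "cnj q = q"
    unfolding q_def cnj_sum
    by (subst sum.swap)
      (auto intro!: sum.cong simp: symmetric_mat_index[OF A sym] algebra_simps)
  then have "cnj z * complex_of_real s = z * complex_of_real s" by (simp add: q)
  moreover have "s > 0"
  proof -
    obtain i where "i < n" "v $ i \<noteq> 0" using v by (metis eq_vecI carrier_vecD index_zero_vec)
    then show ?thesis unfolding s_def by (intro sum_pos2[of _ i]) auto
  qed
  ultimately have "cnj z = z" by simp
  then have z: "z = complex_of_real (Re z)" by (simp add: complex_eq_iff)
  have "poly (map_poly complex_of_real (char_poly A)) (complex_of_real (Re z)) = 0"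
    using ev eigenvalue_root_char_poly[OF cA] z of_real_hom.char_poly_hom[OF A] by metis
  then have "poly (char_poly A) (Re z) = 0"
    by (metis of_real_hom.hom_zero of_real_eq_iff of_real_hom.poly_map_poly)
  then show ?thesis
    using that[OF z] eigenvalue_root_char_poly[OF A] by blast
qed

lemma spectral_radius_scale_less_1:
  assumes A: "A \<in> carrier_mat n n" and n: "n > 0" and r: "spectral_radius A < r" "0 < r"
  shows "spectral_radius (complex_of_real (1 / r) \<cdot>\<^sub>m A) < 1"
proof -
  let ?C = "complex_of_real (1 / r) \<cdot>\<^sub>m A"
  have C: "?C \<in> carrier_mat n n" using A by simp
  obtain z where z: "eigenvalue ?C z" "spectral_radius ?C = cmod z"
    using spectral_radius_mem_max(1)[OF C n] by (auto simp: spectrum_def)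
  then obtain v where v: "v \<in> carrier_vec n" "v \<noteq> 0\<^sub>v n" "?C *\<^sub>v v = z \<cdot>\<^sub>v v"
    using A unfolding eigenvalue_def eigenvector_def by auto
  have "A *\<^sub>v v = (of_real r * z) \<cdot>\<^sub>v v"
  proof (rule eq_vecI)
    fix i assume "i < dim_vec ((of_real r * z) \<cdot>\<^sub>v v)"
    then have i: "i < n" using v by simp
    have "(?C *\<^sub>v v) $ i = z * v $ i" unfolding v(3) using v i by simp
    moreover have "(?C *\<^sub>v v) $ i = complex_of_real (1 / r) * (A *\<^sub>v v) $ i"
      using A v(1) i by (simp add: scalar_prod_def sum_distrib_left mult.assoc)
    ultimately show "(A *\<^sub>v v) $ i = ((of_real r * z) \<cdot>\<^sub>v v) $ i"
      using v i r by (simp add: field_simps)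
  qed (use A v in auto)
  then have "eigenvalue A (of_real r * z)"
    using v A unfolding eigenvalue_def eigenvector_def by auto
  then have "cmod (of_real r * z) \<le> spectral_radius A"
    by (intro spectral_radius_mem_max(2)[OF A n]) (auto simp: spectrum_def)
  then have "r * cmod z \<le> spectral_radius A" using r by (simp add: norm_mult)
  with r have "r * cmod z < r * 1" by linarith
  then show ?thesis using r z by simp
qed

lemma pow_mat_symmetric:
  assumes A: "A \<in> carrier_mat n n" and sym: "transpose_mat A = A"
  shows "transpose_mat (A ^\<^sub>m k) = (A ^\<^sub>m k :: real mat)"
proof (induction k)
  case (Suc k)
  have "A * A ^\<^sub>m k = A ^\<^sub>m k * A"
  proof (induction k)
    case (Suc k)
    have "A * (A ^\<^sub>m k * A) = A * A ^\<^sub>m k * A"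
      using A by (intro assoc_mult_mat[symmetric, of _ n n _ n _ n]) auto
    then show ?case using Suc.IH by simp
  qed (use A in auto)
  then show ?case using A Suc by (simp add: transpose_mult[of _ n n _ n] sym)
qed (use A in auto)

text \<open>
  Cauchy-Schwarz for \<open>x\<close> and \<open>A\<^sup>k x\<close>, since symmetry makes
  \<open>\<bar>A\<^sup>k x\<bar>\<^sup>2\<close> the quadratic form of \<open>A\<^sup>2\<^sup>k\<close> at \<open>x\<close>.
\<close>

lemma quad_form_pow_double:
  assumes A: "A \<in> carrier_mat n n" and sym: "transpose_mat A = A"
  shows "(quad_form (A ^\<^sub>m k) x)\<^sup>2 \<le> (\<Sum>i<n. (x i)\<^sup>2) * quad_form (A ^\<^sub>m (2 * k)) x"
proof -
  define B where "B = A ^\<^sub>m k"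
  have B: "B \<in> carrier_mat n n" using A by (simp add: B_def)
  have symB: "transpose_mat B = B" unfolding B_def by (rule pow_mat_symmetric[OF A sym])
  have double: "A ^\<^sub>m (2 * k) = B * B"
  proof -
    have "A ^\<^sub>m (k + l) = A ^\<^sub>m k * A ^\<^sub>m l" for l
      by (induction l) (use A in \<open>auto simp: assoc_mult_mat[of _ n n _ n _ n]\<close>)
    then show ?thesis by (simp add: mult_2 B_def)
  qed
  define y where "y i = (\<Sum>j<n. B $$ (i, j) * x j)" for i
  have "quad_form B x = (\<Sum>i<n. x i * y i)"
    using B by (simp add: quad_form_def y_def sum_distrib_left mult.assoc)
  then have "(quad_form B x)\<^sup>2 \<le> (\<Sum>i<n. (x i)\<^sup>2) * (\<Sum>i<n. (y i)\<^sup>2)"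
    by (simp add: Cauchy_Schwarz_ineq_sum)
  also have "(\<Sum>m<n. (y m)\<^sup>2)
      = (\<Sum>m<n. \<Sum>i<n. \<Sum>j<n. x i * (B $$ (i, m) * B $$ (m, j)) * x j)"
    unfolding y_def power2_eq_square sum_product
    by (auto intro!: sum.cong simp: symmetric_mat_index[OF B symB] algebra_simps)
  also have "\<dots> = (\<Sum>i<n. \<Sum>j<n. x i * (\<Sum>m<n. B $$ (i, m) * B $$ (m, j)) * x j)"
    unfolding sum_distrib_left sum_distrib_right
    by (subst sum.swap, rule sum.cong, simp, subst sum.swap, simp)
  also have "\<dots> = quad_form (B * B) x"
    using B by (auto simp: quad_form_def scalar_prod_def atLeast0LessThan intro!: sum.cong)
  finally show ?thesis by (simp add: B_def[symmetric] double)
qed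

lemma real_spectral_radius_nonneg:
  assumes "A \<in> carrier_mat n n" "n > 0"
  shows "real_spectral_radius A \<ge> 0"
  using spectral_radius_mem_max(1)[of "map_mat complex_of_real A" n] assms
  by (auto simp: real_spectral_radius_def)

text \<open>
  The Rayleigh bound, obtained without diagonalizing. If it failed, some \<open>r\<close> would lie strictly
  between the spectral radius and the Rayleigh quotient of \<open>x\<close>. The powers of \<open>A / r\<close> are bounded
  because its spectral radius is below 1, while \<open>quad_form_pow_double\<close> lets the quadratic
  form of \<open>(A / r)^(2^m)\<close> at \<open>x\<close> grow without bound by repeated squaring.
\<close>

lemma quad_form_le_spectral_radius:
  assumes A: "A \<in> carrier_mat n n" and sym: "transpose_mat A = A" and n: "n > 0"
  shows "quad_form A x \<le> real_spectral_radius A * (\<Sum>i<n. (x i)\<^sup>2)"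
proof (rule ccontr)
  assume contra: "\<not> ?thesis"
  let ?cA = "map_mat complex_of_real A"
  define s where "s = (\<Sum>i<n. (x i)\<^sup>2)"
  have cA: "?cA \<in> carrier_mat n n" using A by simp
  have rho: "real_spectral_radius A \<ge> 0" by (rule real_spectral_radius_nonneg[OF A n])
  have "s > 0"
  proof (rule ccontr)
    assume "\<not> s > 0"
    moreover have "s \<ge> 0" unfolding s_def by (simp add: sum_nonneg)
    ultimately have "s = 0" by simp
    then have "x i = 0" if "i < n" for i
      using that by (auto simp: s_def sum_nonneg_eq_0_iff)
    then have "quad_form A x = 0" using A by (simp add: quad_form_def)
    then show False using contra \<open>s = 0\<close> by (simp add: s_def)
  qed
  have "real_spectral_radius A < quad_form A x / s"
    using contra \<open>s > 0\<close> by (simp add: s_def field_simps)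
  then obtain r where r: "real_spectral_radius A < r" "r < quad_form A x / s"
    using dense by blast
  define C where "C = (1 / r) \<cdot>\<^sub>m A"
  have C: "C \<in> carrier_mat n n" using A by (simp add: C_def)
  have symC: "transpose_mat C = C"
    using sym A by (auto simp: C_def intro!: eq_matI symmetric_mat_index)
  have cC: "map_mat complex_of_real C = complex_of_real (1 / r) \<cdot>\<^sub>m ?cA"
    using A by (auto simp: C_def)
  have "spectral_radius (map_mat complex_of_real C) < 1"
    unfolding cC by (rule spectral_radius_scale_less_1[OF cA n])
      (use r rho in \<open>auto simp: real_spectral_radius_def\<close>)
  then obtain c where c: "\<And>k. norm_bound (map_mat complex_of_real C ^\<^sub>m k) c"
    using spectral_radius_jnf_norm_bound_less_1_upper_triangular[of "map_mat complex_of_real C" n] C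
    by auto
  have entry: "\<bar>(C ^\<^sub>m k) $$ (i, j)\<bar> \<le> c" if "i < n" "j < n" for i j k
  proof -
    have "map_mat complex_of_real C ^\<^sub>m k = map_mat complex_of_real (C ^\<^sub>m k)"
      by (rule of_real_hom.mat_hom_pow[OF C, symmetric])
    then show ?thesis using c[of k] that C by (auto simp: norm_bound_def)
  qed
  define b where "b = c * (\<Sum>i<n. \<Sum>j<n. \<bar>x i\<bar> * \<bar>x j\<bar>)"
  have bound: "quad_form (C ^\<^sub>m k) x \<le> b" for k
  proof -
    have "x i * (C ^\<^sub>m k) $$ (i, j) * x j \<le> c * (\<bar>x i\<bar> * \<bar>x j\<bar>)" if "i < n" "j < n" for i j
    proof -
      have "x i * (C ^\<^sub>m k) $$ (i, j) * x j \<le> \<bar>(C ^\<^sub>m k) $$ (i, j)\<bar> * (\<bar>x i\<bar> * \<bar>x j\<bar>)"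
        using abs_ge_self[of "x i * (C ^\<^sub>m k) $$ (i, j) * x j"] by (simp add: abs_mult mult_ac)
      then show ?thesis
        using mult_right_mono[OF entry[OF that, of k], of "\<bar>x i\<bar> * \<bar>x j\<bar>"] by simp
    qed
    then have "(\<Sum>i<n. \<Sum>j<n. x i * (C ^\<^sub>m k) $$ (i, j) * x j)
        \<le> (\<Sum>i<n. \<Sum>j<n. c * (\<bar>x i\<bar> * \<bar>x j\<bar>))"
      by (intro sum_mono) auto
    then show ?thesis using C by (simp add: quad_form_def b_def sum_distrib_left)
  qed
  define \<beta> where "\<beta> = quad_form C x / s"
  have "quad_form C x = quad_form A x / r"
    using A by (simp add: quad_form_def C_def sum_divide_distrib)
  then have "r * s < r * quad_form C x"
    using r rho \<open>s > 0\<close> by (simp add: field_simps)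
  then have \<beta>: "\<beta> > 1"
    using r rho \<open>s > 0\<close> by (simp add: \<beta>_def)
  have growth: "s * \<beta> ^ (2 ^ m) \<le> quad_form (C ^\<^sub>m (2 ^ m)) x" for m
  proof (induction m)
    case 0
    then show ?case using \<open>s > 0\<close> C by (simp add: \<beta>_def)
  next
    case (Suc m)
    have "(s * \<beta> ^ (2 ^ m))\<^sup>2 \<le> (quad_form (C ^\<^sub>m (2 ^ m)) x)\<^sup>2"
      using Suc \<open>s > 0\<close> \<beta> by (intro power_mono) auto
    also have "\<dots> \<le> s * quad_form (C ^\<^sub>m (2 * 2 ^ m)) x"
      unfolding s_def by (rule quad_form_pow_double[OF C symC])
    also have "(s * \<beta> ^ (2 ^ m))\<^sup>2 = s * (s * \<beta> ^ (2 ^ Suc m))"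
      by (simp only: power_mult_distrib power2_eq_square power_Suc mult_2 power_add mult_ac)
    finally have "s * (s * \<beta> ^ (2 ^ Suc m)) \<le> s * quad_form (C ^\<^sub>m (2 ^ Suc m)) x"
      by simp
    then show ?case using \<open>s > 0\<close> by simp
  qed
  obtain m where m: "b / s < \<beta> ^ m" using real_arch_pow[OF \<beta>] by blast
  also have "\<beta> ^ m \<le> \<beta> ^ (2 ^ m)" using \<beta> by (intro power_increasing) (auto simp: less_imp_le)
  finally have "b < s * \<beta> ^ (2 ^ m)" using \<open>s > 0\<close> by (simp add: field_simps)
  then show False using growth[of m] bound[of "2 ^ m"] by simp
qed

text \<open>
  Symmetry turns complex eigenvalues into real ones and positivity of the quadratic form at the
  eigenvectors makes these nonnegative, so taking absolute values over the complex spectrum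
  reproduces the real spectrum.
\<close>

lemma psd_spectrum:
  assumes A: "psd_mat n A" and n: "n > 0"
  shows "largest_eigenvalue A = real_spectral_radius A"
    and "eigenvalue A (real_spectral_radius A)"
proof -
  have carr: "A \<in> carrier_mat n n" and sym: "transpose_mat A = A"
    and pos: "\<And>x. 0 \<le> quad_form A x"
    using A by (auto simp: psd_mat_def)
  let ?cA = "map_mat complex_of_real A"
  have cA: "?cA \<in> carrier_mat n n" using carr by simp
  have nonneg: "l \<ge> 0" if "eigenvalue A l" for l
    using eigenvalue_imp_quad_form[OF carr that] pos by (metis zero_le_mult_iff not_less)
  have spec: "spectrum ?cA = complex_of_real ` spectrum A"
  proof (intro equalityI subsetI)
    fix z assume "z \<in> spectrum ?cA"
    then show "z \<in> complex_of_real ` spectrum A"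
      using symmetric_complex_eigenvalue[OF carr sym] unfolding spectrum_def
      by (metis imageI mem_Collect_eq)
  next
    fix z assume "z \<in> complex_of_real ` spectrum A"
    then show "z \<in> spectrum ?cA"
      using of_real_hom.eigenvalue_hom[OF carr] unfolding spectrum_def by auto
  qed
  have "norm ` spectrum ?cA = spectrum A"
    unfolding spec image_image using nonneg by (force simp: spectrum_def)
  then show eq: "largest_eigenvalue A = real_spectral_radius A"
    by (simp add: largest_eigenvalue_def real_spectral_radius_def spectral_radius_def)
  show "eigenvalue A (real_spectral_radius A)"
    using spectral_radius_mem_max(1)[OF cA n] \<open>norm ` spectrum ?cA = spectrum A\<close>
    by (simp add: real_spectral_radius_def spectrum_def)
qed

lemma spectral_radius_le_row_sum_norm:
  assumes A: "psd_mat n A" and n: "n > 0"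
  shows "real_spectral_radius A \<le> row_sum_norm A"
proof -
  have carr: "A \<in> carrier_mat n n" and sym: "transpose_mat A = A"
    using A by (auto simp: psd_mat_def)
  obtain x where "(\<Sum>i<n. (x i)\<^sup>2) > 0" "quad_form A x = real_spectral_radius A * (\<Sum>i<n. (x i)\<^sup>2)"
    using eigenvalue_imp_quad_form[OF carr psd_spectrum(2)[OF A n]] .
  then show ?thesis using quad_form_le_row_sum_norm[OF carr sym, of x] by simp
qed

text \<open>
  Compare the quadratic forms at an eigenvector of \<open>A\<close> for its spectral radius: that of \<open>B\<close> is
  bounded by Rayleigh, that of \<open>A - B\<close> by Schur's test.
\<close>

lemma spectral_radius_perturb:
  assumes A: "psd_mat n A" and B: "psd_mat n B" and n: "n > 0"
  shows "real_spectral_radius A \<le> real_spectral_radius B + row_sum_norm (A - B)"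
proof -
  have carr: "A \<in> carrier_mat n n" "B \<in> carrier_mat n n"
    and sym: "transpose_mat A = A" "transpose_mat B = B"
    using A B by (auto simp: psd_mat_def)
  obtain x where x: "(\<Sum>i<n. (x i)\<^sup>2) > 0"
    and eq: "quad_form A x = real_spectral_radius A * (\<Sum>i<n. (x i)\<^sup>2)"
    using eigenvalue_imp_quad_form[OF carr(1) psd_spectrum(2)[OF A n]] .
  have AB: "A - B \<in> carrier_mat n n" "transpose_mat (A - B) = A - B"
    using carr sym by (auto simp: transpose_minus[of _ n n])
  have "quad_form A x = quad_form B x + quad_form (A - B) x"
    by (simp add: quad_form_diff[OF carr])
  also have "\<dots> \<le> (real_spectral_radius B + row_sum_norm (A - B)) * (\<Sum>i<n. (x i)\<^sup>2)"
    using quad_form_le_spectral_radius[OF carr(2) sym(2) n, of x]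
      quad_form_le_row_sum_norm[OF AB, of x] by (simp add: distrib_right)
  finally show ?thesis using x eq by simp
qed

lemma spectral_radius_diff_le:
  assumes A: "psd_mat n A" and B: "psd_mat n B" and n: "n > 0"
  shows "\<bar>real_spectral_radius A - real_spectral_radius B\<bar> \<le> row_sum_norm (A - B)"
proof -
  have carr: "A \<in> carrier_mat n n" "B \<in> carrier_mat n n"
    using A B by (auto simp: psd_mat_def)
  show ?thesis
    using spectral_radius_perturb[OF A B n] spectral_radius_perturb[OF B A n]
      row_sum_norm_minus_commute[OF carr] by linarith
qed

section \<open>The ergodic theorem for irreducible finite Markov chains\<close>

definition irreducible_kernel :: "'s set \<Rightarrow> ('s \<Rightarrow> 's pmf) \<Rightarrow> bool" where
  "irreducible_kernel S p \<longleftrightarrow>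
     (\<forall>s\<in>S. \<forall>t\<in>S. (s, t) \<in> {(s, t). s \<in> S \<and> t \<in> S \<and> pmf (p s) t > 0}\<^sup>*)"

definition invariant_on :: "'s set \<Rightarrow> ('s \<Rightarrow> 's pmf) \<Rightarrow> ('s \<Rightarrow> real) \<Rightarrow> bool" where
  "invariant_on S p \<nu> \<longleftrightarrow> (\<forall>t\<in>S. (\<Sum>s\<in>S. \<nu> s * pmf (p s) t) = \<nu> t)"

text \<open>
  Subtract from \<open>\<nu>\<close> the largest multiple of \<open>\<mu>\<close> that leaves a nonnegative function. The
  difference is invariant and vanishes somewhere, hence everywhere by irreducibility.
\<close>

lemma invariant_unique:
  fixes \<mu> \<nu> :: "'s \<Rightarrow> real"
  assumes fin: "finite S" and irr: "irreducible_kernel S p"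
    and \<mu>: "invariant_on S p \<mu>" "\<And>s. s \<in> S \<Longrightarrow> \<mu> s > 0" and \<nu>: "invariant_on S p \<nu>"
    and mass: "sum \<mu> S = 1" "sum \<nu> S = 1"
  shows "\<forall>s\<in>S. \<nu> s = \<mu> s"
proof -
  have ne: "S \<noteq> {}" using mass by auto
  define c where "c = Min ((\<lambda>s. \<nu> s / \<mu> s) ` S)"
  have "c \<in> (\<lambda>s. \<nu> s / \<mu> s) ` S" unfolding c_def using fin ne by (intro Min_in) auto
  then obtain t0 where t0: "t0 \<in> S" "c = \<nu> t0 / \<mu> t0" by auto
  define \<delta> where "\<delta> s = \<nu> s - c * \<mu> s" for s
  have \<delta>0: "\<delta> t0 = 0" using t0 \<mu>(2)[of t0] by (simp add: \<delta>_def)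
  have nonneg: "\<delta> s \<ge> 0" if "s \<in> S" for s
  proof -
    have "c \<le> \<nu> s / \<mu> s" unfolding c_def using fin that by (intro Min_le) auto
    then show ?thesis using \<mu>(2)[OF that] by (simp add: \<delta>_def field_simps)
  qed
  have inv: "(\<Sum>s\<in>S. \<delta> s * pmf (p s) t) = \<delta> t" if "t \<in> S" for t
    using \<mu>(1) \<nu> that
    by (simp add: invariant_on_def \<delta>_def left_diff_distrib sum_subtractf mult.assoc
        sum_distrib_left[symmetric])
  \<comment> \<open>A zero of the invariant nonnegative function \<open>\<delta>\<close> propagates to all predecessors.\<close>
  have "\<delta> s = 0" if "s \<in> S" for s
  proof -
    have "(s, t0) \<in> {(s, t). s \<in> S \<and> t \<in> S \<and> pmf (p s) t > 0}\<^sup>*"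
      using irr that t0 by (auto simp: irreducible_kernel_def)
    then show ?thesis
    proof (induction rule: converse_rtrancl_induct)
      case base
      show ?case by (rule \<delta>0)
    next
      case (step s t)
      then have st: "s \<in> S" "t \<in> S" "pmf (p s) t > 0" by auto
      have "(\<Sum>s\<in>S. \<delta> s * pmf (p s) t) = 0" using inv st step by simp
      then have "\<delta> s * pmf (p s) t = 0"
        using st nonneg fin by (subst (asm) sum_nonneg_eq_0_iff) auto
      then show ?case using st by simp
    qed
  qed
  then have eq: "\<nu> s = c * \<mu> s" if "s \<in> S" for s using that by (simp add: \<delta>_def)
  then have "sum \<nu> S = c * sum \<mu> S" by (simp add: sum_distrib_left)
  then have "c = 1" using mass by simp
  then show ?thesis using eq by simp
qed

text \<open>
  Every limit point of the sequence \<open>\<pi>\<close> is invariant with total mass 1, hence equal to \<open>\<mu>\<close>, and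
  the sequence stays in a compact set.
\<close>

lemma asymptotically_invariant_tendsto:
  fixes \<pi> :: "nat \<Rightarrow> 's \<Rightarrow> real"
  assumes fin: "finite S" and irr: "irreducible_kernel S p"
    and \<mu>: "invariant_on S p \<mu>" "\<And>s. s \<in> S \<Longrightarrow> \<mu> s > 0" "sum \<mu> S = 1"
    and bd: "\<And>n s. s \<in> S \<Longrightarrow> \<bar>\<pi> n s\<bar> \<le> 1"
    and mass: "(\<lambda>n. \<Sum>s\<in>S. \<pi> n s) \<longlonglongrightarrow> 1"
    and asym: "\<And>t. t \<in> S \<Longrightarrow> (\<lambda>n. \<pi> n t - (\<Sum>s\<in>S. \<pi> n s * pmf (p s) t)) \<longlonglongrightarrow> 0"
    and t: "t \<in> S"
  shows "(\<lambda>n. \<pi> n t) \<longlonglongrightarrow> \<mu> t"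
proof (rule ccontr)
  assume "\<not> ?thesis"
  then obtain \<epsilon> where \<epsilon>: "\<epsilon> > 0" "\<not> (\<forall>\<^sub>F n in sequentially. dist (\<pi> n t) (\<mu> t) < \<epsilon>)"
    unfolding tendsto_iff by auto
  obtain r :: "nat \<Rightarrow> nat" where r: "strict_mono r" "\<And>n. \<not> dist (\<pi> (r n) t) (\<mu> t) < \<epsilon>"
    using not_eventually_sequentiallyD[OF \<epsilon>(2)] by blast
  have "\<forall>\<delta>\<subseteq>S. \<exists>l. \<exists>r'. strict_mono r' \<and>
      (\<forall>\<epsilon>>0. \<forall>\<^sub>F n in sequentially. \<forall>s\<in>\<delta>. dist (\<pi> (r (r' n)) s) (l s) < \<epsilon>)"
    by (rule compact_lemma_general[where f = "\<lambda>n. \<pi> (r n)" and proj = "\<lambda>x k. x k"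
          and unproj = "\<lambda>x. x"])
      (auto simp: fin bounded_iff intro!: exI[of _ 1] bd)
  then obtain l r' where r': "strict_mono r'"
    and l: "\<And>\<epsilon>. \<epsilon> > 0 \<Longrightarrow> \<forall>\<^sub>F n in sequentially. \<forall>s\<in>S. dist (\<pi> (r (r' n)) s) (l s) < \<epsilon>"
    by blast
  have lim: "(\<lambda>n. \<pi> (r (r' n)) s) \<longlonglongrightarrow> l s" if "s \<in> S" for s
    unfolding tendsto_iff
  proof (intro allI impI)
    fix e :: real assume "e > 0"
    from l[OF this] show "\<forall>\<^sub>F n in sequentially. dist (\<pi> (r (r' n)) s) (l s) < e"
      by (rule eventually_mono) (use that in auto)
  qed
  have rr: "strict_mono (r \<circ> r')" using r r' by (simp add: strict_mono_o)
  have sub: "(\<lambda>n. g (r (r' n))) \<longlonglongrightarrow> L" if "g \<longlonglongrightarrow> L" for g :: "nat \<Rightarrow> real" and L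
    using LIMSEQ_subseq_LIMSEQ[OF that rr] by (simp add: o_def)
  have "invariant_on S p l"
    unfolding invariant_on_def
  proof
    fix u assume u: "u \<in> S"
    have "(\<lambda>n. \<pi> (r (r' n)) u - (\<Sum>s\<in>S. \<pi> (r (r' n)) s * pmf (p s) u))
        \<longlonglongrightarrow> l u - (\<Sum>s\<in>S. l s * pmf (p s) u)"
      by (intro tendsto_intros lim u)
    from LIMSEQ_unique[OF this sub[OF asym[OF u]]]
    show "(\<Sum>s\<in>S. l s * pmf (p s) u) = l u" by simp
  qed
  moreover have "sum l S = 1"
  proof -
    have "(\<lambda>n. \<Sum>s\<in>S. \<pi> (r (r' n)) s) \<longlonglongrightarrow> sum l S"
      by (intro tendsto_intros lim)
    from LIMSEQ_unique[OF this sub[OF mass]] show ?thesis .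
  qed
  ultimately have "l t = \<mu> t" using invariant_unique[OF fin irr \<mu>(1,2)] \<mu>(3) t by blast
  then have "\<forall>\<^sub>F n in sequentially. dist (\<pi> (r (r' n)) t) (\<mu> t) < \<epsilon>"
    using lim[OF t] \<epsilon>(1) by (simp add: tendsto_iff)
  then show False using r(2) by (auto simp: eventually_sequentially)
qed

text \<open>
  Between consecutive squares the sequence moves by at most twice the square root of the index,
  which is negligible after division by the index.
\<close>

lemma tendsto_of_square_subsequence:
  fixes a :: "nat \<Rightarrow> real"
  assumes step: "\<And>n. \<bar>a (Suc n) - a n\<bar> \<le> 1"
    and sq: "(\<lambda>n. a (n\<^sup>2) / real (n\<^sup>2)) \<longlonglongrightarrow> 0"
  shows "(\<lambda>n. a n / real n) \<longlonglongrightarrow> 0"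
proof -
  have lip: "\<bar>a (m + k) - a m\<bar> \<le> real k" for m k
  proof (induction k)
    case (Suc k)
    then show ?case using step[of "m + k"] by simp
  qed simp
  define r where "r n = floor_sqrt n" for n
  have r_top: "filterlim r at_top sequentially"
    unfolding filterlim_at_top
  proof
    fix m
    show "\<forall>\<^sub>F n in sequentially. m \<le> r n"
      using eventually_ge_at_top[of "m\<^sup>2"] by eventually_elim (simp add: r_def le_floor_sqrtI)
  qed
  have "(\<lambda>n. \<bar>a ((r n)\<^sup>2) / real ((r n)\<^sup>2)\<bar> + 2 / real (r n)) \<longlonglongrightarrow> 0"
  proof -
    have "(\<lambda>m. \<bar>a (m\<^sup>2) / real (m\<^sup>2)\<bar> + 2 / real m) \<longlonglongrightarrow> 0"
      using tendsto_add[OF tendsto_rabs_zero[OF sq] lim_const_over_n[of "2::real"]] by simp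
    then show ?thesis by (rule filterlim_compose[OF _ r_top])
  qed
  moreover have "\<forall>\<^sub>F n in sequentially.
      norm (a n / real n) \<le> \<bar>a ((r n)\<^sup>2) / real ((r n)\<^sup>2)\<bar> + 2 / real (r n)"
    using eventually_gt_at_top[of 0]
  proof eventually_elim
    case (elim n)
    have r: "r n > 0" "(r n)\<^sup>2 \<le> n" "n < (Suc (r n))\<^sup>2"
      using elim Suc_floor_sqrt_power2_gt[of n] by (auto simp: r_def)
    define k where "k = n - (r n)\<^sup>2"
    have n: "n = (r n)\<^sup>2 + k" and k: "k \<le> 2 * r n"
      using r by (auto simp: k_def power2_eq_square)
    have r2: "real ((r n)\<^sup>2) \<le> real n" "0 < real ((r n)\<^sup>2)" using r by auto
    have "\<bar>a n\<bar> \<le> \<bar>a ((r n)\<^sup>2)\<bar> + real k"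
      using lip[of "(r n)\<^sup>2" k] n by simp
    then have "\<bar>a n\<bar> / real n \<le> (\<bar>a ((r n)\<^sup>2)\<bar> + 2 * real (r n)) / real n"
      using k by (intro divide_right_mono) auto
    also have "\<dots> \<le> (\<bar>a ((r n)\<^sup>2)\<bar> + 2 * real (r n)) / real ((r n)\<^sup>2)"
      using r2 elim by (intro divide_left_mono mult_pos_pos) auto
    also have "\<dots> = \<bar>a ((r n)\<^sup>2) / real ((r n)\<^sup>2)\<bar> + 2 / real (r n)"
      using r by (simp add: add_divide_distrib power2_eq_square)
    finally show ?case by simp
  qed
  ultimately show ?thesis by (rule Lim_null_comparison[rotated])
qed

text \<open>
  The Markov property in \<open>markov_chain\<close> is about the whole past, so the arguments below are
  phrased with the history up to time \<open>n\<close>, a random variable with finitely many values.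
\<close>

locale finite_markov_chain = prob_space P
  for P :: "'w measure" +
  fixes S :: "'s set" and p :: "'s \<Rightarrow> 's pmf" and Y :: "nat \<Rightarrow> 'w \<Rightarrow> 's"
  assumes finite_states: "finite S" and chain: "markov_chain P S p Y"
begin

lemma state_measurable: "k \<ge> 1 \<Longrightarrow> Y k \<in> P \<rightarrow>\<^sub>M count_space S"
  using chain by (simp add: markov_chain_def)

lemma state_in: "k \<ge> 1 \<Longrightarrow> w \<in> space P \<Longrightarrow> Y k w \<in> S"
  using measurable_space[OF state_measurable] by auto

definition history :: "nat \<Rightarrow> 'w \<Rightarrow> nat \<Rightarrow> 's" where
  "history n w = (\<lambda>k\<in>{1..n}. Y k w)"

abbreviation histories :: "nat \<Rightarrow> (nat \<Rightarrow> 's) set" where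
  "histories n \<equiv> {1..n} \<rightarrow>\<^sub>E S"

lemma finite_histories: "finite (histories n)"
  by (simp add: finite_PiE finite_states)

lemma history_measurable: "history n \<in> P \<rightarrow>\<^sub>M count_space (histories n)"
proof -
  have "history n \<in> P \<rightarrow>\<^sub>M PiM {1..n} (\<lambda>_. count_space S)"
    unfolding history_def[abs_def] by (intro measurable_restrict state_measurable) auto
  also have "PiM {1..n} (\<lambda>_. count_space S) = count_space (histories n)"
    by (intro count_space_PiM_finite) (auto simp: finite_states countable_finite)
  finally show ?thesis .
qed

lemma history_in: "w \<in> space P \<Longrightarrow> history n w \<in> histories n"
  using measurable_space[OF history_measurable] by auto

lemma history_fun_measurable: "(\<lambda>w. h (history n w)) \<in> borel_measurable P"
  by (rule measurable_compose[OF history_measurable]) simp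

lemma history_event: "{w \<in> space P. Q (history n w)} \<in> sets P"
proof -
  have eq: "{w \<in> space P. Q (history n w)} = history n -` {s \<in> histories n. Q s} \<inter> space P"
    using history_in by auto
  show ?thesis unfolding eq by (rule measurable_sets[OF history_measurable]) auto
qed

lemma history_fun_integrable: "integrable P (\<lambda>w. h (history n w) :: real)"
proof (rule integrable_const_bound)
  show "AE w in P. norm (h (history n w)) \<le> Max ((\<lambda>s. \<bar>h s\<bar>) ` histories n)"
    using history_in finite_histories by (intro AE_I2) (auto intro!: Max_ge)
qed (rule history_fun_measurable)

lemma expectation_history_fun:
  "expectation (\<lambda>w. h (history n w)) = (\<Sum>s\<in>histories n. h s * prob {w \<in> space P. history n w = s})"
proof -
  let ?A = "\<lambda>s. {w \<in> space P. history n w = s}"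
  have "expectation (\<lambda>w. h (history n w)) = expectation (\<lambda>w. \<Sum>s\<in>histories n. h s * indicator (?A s) w)"
  proof (intro Bochner_Integration.integral_cong refl)
    fix w assume w: "w \<in> space P"
    have "(\<Sum>s\<in>histories n. h s * indicator (?A s) w)
        = (\<Sum>s\<in>histories n. if s = history n w then h s else 0)"
      using w by (intro sum.cong) (auto simp: indicator_def)
    then show "h (history n w) = (\<Sum>s\<in>histories n. h s * indicator (?A s) w)"
      using history_in[OF w, of n] finite_histories[of n] by simp
  qed
  also have "\<dots> = (\<Sum>s\<in>histories n. expectation (\<lambda>w. h s * indicator (?A s) w))"
    by (intro Bochner_Integration.integral_sum integrable_mult_right)
      (auto intro!: integrable_real_indicator history_event simp: less_top[symmetric])
  also have "\<dots> = (\<Sum>s\<in>histories n. h s * prob (?A s))"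
    by (intro sum.cong refl) (simp add: history_event Int_absorb2)
  finally show ?thesis .
qed

text \<open>
  The innovation at time \<open>k\<close>: the indicator of a visit to \<open>t\<close> at time \<open>Suc k\<close>, minus the
  conditional probability of this visit given the past.
\<close>

definition innov :: "'s \<Rightarrow> nat \<Rightarrow> 'w \<Rightarrow> real" where
  "innov t k w = of_bool (Y (Suc k) w = t) - pmf (p (Y k w)) t"

lemma abs_innov_le: "\<bar>innov t k w\<bar> \<le> 1"
  using pmf_le_1[of "p (Y k w)" t] pmf_nonneg[of "p (Y k w)" t]
  by (auto simp: innov_def of_bool_def)

text \<open>
  The Markov property, weighted with \<open>h\<close> and summed over all histories. Histories of length
  \<open>Suc n\<close> that end in \<open>t\<close> are the one-step extensions of histories of length \<open>n\<close>.
\<close>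

lemma innov_orthogonal:
  assumes n: "n \<ge> 1" and t: "t \<in> S"
  shows "expectation (\<lambda>w. h (history n w) * innov t n w) = 0"
proof -
  let ?H = "\<lambda>n s. {w \<in> space P. history n w = s}"
  let ?r = "\<lambda>s. restrict s {1..n}"
  have hist: "?r (history (Suc n) w) = history n w" for w
    by (auto simp: history_def)
  have g: "h (history n w) * innov t n w = h (history n w) * of_bool (history (Suc n) w (Suc n) = t)
      - h (history n w) * pmf (p (history n w n)) t" for w
    using n by (simp add: innov_def history_def right_diff_distrib)
  have "expectation (\<lambda>w. h (history n w) * of_bool (history (Suc n) w (Suc n) = t))
      = (\<Sum>s\<in>histories n. h s * pmf (p (s n)) t * prob (?H n s))"
  proof -
    let ?ext = "\<lambda>s. s(Suc n := t)"
    have "expectation (\<lambda>w. h (history n w) * of_bool (history (Suc n) w (Suc n) = t))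
        = expectation (\<lambda>w. (\<lambda>s. h (?r s) * of_bool (s (Suc n) = t)) (history (Suc n) w))"
      by (simp only: hist)
    also have "\<dots> = (\<Sum>s\<in>histories (Suc n). h (?r s) * of_bool (s (Suc n) = t) * prob (?H (Suc n) s))"
      by (rule expectation_history_fun)
    also have "\<dots> = (\<Sum>s\<in>?ext ` histories n. h (?r s) * of_bool (s (Suc n) = t) * prob (?H (Suc n) s))"
    proof (rule sum.mono_neutral_right)
      show "finite (histories (Suc n))" by (rule finite_histories)
      show "?ext ` histories n \<subseteq> histories (Suc n)"
        using t by (auto simp: PiE_def Pi_def extensional_def)
      show "\<forall>s\<in>histories (Suc n) - ?ext ` histories n.
          h (?r s) * of_bool (s (Suc n) = t) * prob (?H (Suc n) s) = 0"
      proof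
        fix s assume s: "s \<in> histories (Suc n) - ?ext ` histories n"
        have "s (Suc n) \<noteq> t"
        proof
          assume "s (Suc n) = t"
          then have "s = ?ext (?r s)"
            using s by (auto simp: fun_eq_iff PiE_def extensional_def)
          moreover have "?r s \<in> histories n" using s by (auto simp: PiE_def Pi_def)
          ultimately show False using s by blast
        qed
        then show "h (?r s) * of_bool (s (Suc n) = t) * prob (?H (Suc n) s) = 0" by simp
      qed
    qed
    also have "\<dots> = (\<Sum>s\<in>histories n. h (?r (?ext s)) * prob (?H (Suc n) (?ext s)))"
    proof (subst sum.reindex)
      show "inj_on ?ext (histories n)"
      proof (rule inj_onI)
        fix s s' assume s: "s \<in> histories n" "s' \<in> histories n" "?ext s = ?ext s'"
        show "s = s'"
        proof (rule PiE_ext[OF s(1,2)])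
          fix k assume "k \<in> {1..n}"
          then show "s k = s' k" using fun_cong[OF s(3), of k] by auto
        qed
      qed
    qed simp
    also have "\<dots> = (\<Sum>s\<in>histories n. h s * pmf (p (s n)) t * prob (?H n s))"
    proof (intro sum.cong refl)
      fix s assume s: "s \<in> histories n"
      have r: "?r (?ext s) = s" using s by (auto simp: fun_eq_iff PiE_def extensional_def)
      have "?H (Suc n) (?ext s) = {w \<in> space P. \<forall>k\<in>{1..Suc n}. Y k w = ?ext s k}"
        using s by (auto simp: history_def fun_eq_iff PiE_def extensional_def)
      moreover have "?H n s = {w \<in> space P. \<forall>k\<in>{1..n}. Y k w = ?ext s k}"
        using s by (auto simp: history_def fun_eq_iff PiE_def extensional_def)
      moreover have "?ext s k \<in> S" if "k \<in> {1..Suc n}" for k using that s t by auto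
      then have "prob {w \<in> space P. \<forall>k\<in>{1..Suc n}. Y k w = ?ext s k}
          = prob {w \<in> space P. \<forall>k\<in>{1..n}. Y k w = ?ext s k}
            * pmf (p (?ext s n)) (?ext s (Suc n))"
        by (rule chain[unfolded markov_chain_def, THEN conjunct2, rule_format, OF n])
      ultimately have "prob (?H (Suc n) (?ext s)) = prob (?H n s) * pmf (p (s n)) t"
        by simp
      then show "h (?r (?ext s)) * prob (?H (Suc n) (?ext s)) = h s * pmf (p (s n)) t * prob (?H n s)"
        unfolding r by simp
    qed
    finally show ?thesis .
  qed
  moreover have "expectation (\<lambda>w. h (history n w) * pmf (p (history n w n)) t)
      = (\<Sum>s\<in>histories n. h s * pmf (p (s n)) t * prob (?H n s))"
    by (rule expectation_history_fun[of "\<lambda>s. h s * pmf (p (s n)) t"])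
  moreover have "integrable P (\<lambda>w. h (history n w) * of_bool (history (Suc n) w (Suc n) = t))"
    using history_fun_integrable[of "\<lambda>s. h (?r s) * of_bool (s (Suc n) = t)" "Suc n"]
    by (simp only: hist)
  moreover have "integrable P (\<lambda>w. h (history n w) * pmf (p (history n w n)) t)"
    by (rule history_fun_integrable[of "\<lambda>s. h s * pmf (p (s n)) t"])
  ultimately show ?thesis unfolding g by simp
qed

definition innov_sum :: "'s \<Rightarrow> nat \<Rightarrow> 'w \<Rightarrow> real" where
  "innov_sum t n w = (\<Sum>k=1..n. innov t k w)"

lemma innov_sum_history: "\<exists>g. \<forall>w. innov_sum t n w = g (history (Suc n) w)"
proof (intro exI allI)
  fix w
  show "innov_sum t n w
    = (\<lambda>s. \<Sum>k=1..n. of_bool (s (Suc k) = t) - pmf (p (s k)) t) (history (Suc n) w)"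
    unfolding innov_sum_def innov_def by (intro sum.cong refl) (auto simp: history_def)
qed

lemma innov_history: "n \<ge> 1 \<Longrightarrow> innov t n w
    = (\<lambda>s. of_bool (s (Suc n) = t) - pmf (p (s n)) t) (history (Suc n) w)"
  by (auto simp: innov_def history_def)

lemma innov_sum_measurable: "innov_sum t n \<in> borel_measurable P"
proof -
  obtain g where "\<And>w. innov_sum t n w = g (history (Suc n) w)" using innov_sum_history by blast
  then have "innov_sum t n = (\<lambda>w. g (history (Suc n) w))" by auto
  then show ?thesis by (simp add: history_fun_measurable)
qed

lemma innov_sum_sq_integrable: "integrable P (\<lambda>w. (innov_sum t n w)\<^sup>2)"
proof -
  obtain g where "\<And>w. innov_sum t n w = g (history (Suc n) w)" using innov_sum_history by blast
  then show ?thesis using history_fun_integrable[of "\<lambda>s. (g s)\<^sup>2" "Suc n"] by simp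
qed

text \<open>
  The next innovation is orthogonal to the sum so far, so each step adds at most 1.
\<close>

lemma innov_sum_second_moment:
  assumes t: "t \<in> S"
  shows "expectation (\<lambda>w. (innov_sum t n w)\<^sup>2) \<le> real n"
proof (induction n)
  case 0
  then show ?case by (simp add: innov_sum_def)
next
  case (Suc n)
  obtain g where g: "\<And>w. innov_sum t n w = g (history (Suc n) w)" using innov_sum_history by blast
  let ?M = "innov_sum t n" and ?D = "innov t (Suc n)"
  let ?d = "\<lambda>s. of_bool (s (Suc (Suc n)) = t) - pmf (p (s (Suc n))) t"
  have D: "?D w = ?d (history (Suc (Suc n)) w)" for w
    by (rule innov_history) simp
  have hist: "history (Suc n) w = restrict (history (Suc (Suc n)) w) {1..Suc n}" for w
    by (auto simp: history_def)
  have intD: "integrable P (\<lambda>w. (?D w)\<^sup>2)"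
    unfolding D by (rule history_fun_integrable[of "\<lambda>s. (?d s)\<^sup>2"])
  have intMD: "integrable P (\<lambda>w. ?M w * ?D w)"
    unfolding D g hist
    by (rule history_fun_integrable[of "\<lambda>s. g (restrict s {1..Suc n}) * ?d s"])
  have "expectation (\<lambda>w. (innov_sum t (Suc n) w)\<^sup>2)
      = expectation (\<lambda>w. (?M w)\<^sup>2 + 2 * (?M w * ?D w) + (?D w)\<^sup>2)"
    by (simp add: innov_sum_def power2_sum algebra_simps)
  also have "\<dots> = expectation (\<lambda>w. (?M w)\<^sup>2) + 2 * expectation (\<lambda>w. ?M w * ?D w)
      + expectation (\<lambda>w. (?D w)\<^sup>2)"
    using innov_sum_sq_integrable intD intMD by simp
  also have "expectation (\<lambda>w. ?M w * ?D w) = 0"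
    unfolding g by (rule innov_orthogonal) (use t in auto)
  also have "expectation (\<lambda>w. (?D w)\<^sup>2) \<le> 1"
  proof -
    have "(?D w)\<^sup>2 \<le> 1" for w using abs_innov_le[of t "Suc n" w] by (simp add: abs_square_le_1)
    then show ?thesis using intD by (intro integral_le_const) auto
  qed
  finally show ?case using Suc by simp
qed

text \<open>
  Along the squares, the second moments of the averages are at most \<open>1 / n\<^sup>2\<close>, hence summable, so
  the averages tend to 0 almost surely; \<open>tendsto_of_square_subsequence\<close> fills the gaps.
\<close>

lemma innov_average_tendsto_0:
  assumes t: "t \<in> S"
  shows "AE w in P. (\<lambda>n. innov_sum t n w / real n) \<longlonglongrightarrow> 0"
proof -
  define f where "f n w = (innov_sum t (n\<^sup>2) w / real (n\<^sup>2))\<^sup>2" for n w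
  have f_meas: "f n \<in> borel_measurable P" for n
    unfolding f_def using innov_sum_measurable by measurable
  have f_int: "integrable P (f n)" for n
    using innov_sum_sq_integrable unfolding f_def power_divide by simp
  have f_nonneg: "f n w \<ge> 0" for n w by (simp add: f_def)
  have f_le: "expectation (f n) \<le> inverse (real n ^ 2)" for n
  proof (cases "n = 0")
    case False
    have "expectation (f n) = expectation (\<lambda>w. (innov_sum t (n\<^sup>2) w)\<^sup>2) / (real (n\<^sup>2))\<^sup>2"
      by (simp add: f_def[abs_def] power_divide)
    also have "\<dots> \<le> real (n\<^sup>2) / (real (n\<^sup>2))\<^sup>2"
      by (intro divide_right_mono innov_sum_second_moment t) auto
    also have "\<dots> = inverse (real n ^ 2)"
      using False by (simp add: power2_eq_square field_simps)
    finally show ?thesis .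
  qed (simp add: f_def[abs_def])
  have summable: "summable (\<lambda>n. inverse (real n ^ 2))"
    by (rule inverse_power_summable) simp
  have "(\<integral>\<^sup>+w. (\<Sum>n. ennreal (f n w)) \<partial>P) = (\<Sum>n. \<integral>\<^sup>+w. ennreal (f n w) \<partial>P)"
    using f_meas by (intro nn_integral_suminf) measurable
  also have "\<dots> = (\<Sum>n. ennreal (expectation (f n)))"
    by (intro suminf_cong nn_integral_eq_integral f_int) (simp add: f_nonneg)
  also have "\<dots> \<le> (\<Sum>n. ennreal (inverse (real n ^ 2)))"
    by (intro suminf_le ennreal_leI f_le) auto
  finally have "(\<integral>\<^sup>+w. (\<Sum>n. ennreal (f n w)) \<partial>P) \<le> (\<Sum>n. ennreal (inverse (real n ^ 2)))" .
  moreover have "(\<Sum>n. ennreal (inverse (real n ^ 2))) \<noteq> \<infinity>"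
    unfolding infinity_ennreal_def by (rule ennreal_suminf_neq_top[OF summable]) simp
  ultimately have "(\<integral>\<^sup>+w. (\<Sum>n. ennreal (f n w)) \<partial>P) \<noteq> \<infinity>"
    using neq_top_trans unfolding infinity_ennreal_def by blast
  then have "AE w in P. (\<Sum>n. ennreal (f n w)) \<noteq> \<infinity>"
    using f_meas by (intro nn_integral_noteq_infinite) measurable
  then show ?thesis
  proof (rule AE_mp, intro AE_I2 impI)
    fix w assume "(\<Sum>n. ennreal (f n w)) \<noteq> \<infinity>"
    then have "summable (\<lambda>n. f n w)" by (intro summable_suminf_not_top f_nonneg) simp
    then have "(\<lambda>n. f n w) \<longlonglongrightarrow> 0" by (rule summable_LIMSEQ_zero)
    then have "(\<lambda>n. sqrt (f n w)) \<longlonglongrightarrow> sqrt 0" by (rule tendsto_real_sqrt)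
    then have "(\<lambda>n. \<bar>innov_sum t (n\<^sup>2) w / real (n\<^sup>2)\<bar>) \<longlonglongrightarrow> 0"
      by (simp add: f_def del: of_nat_power)
    then have "(\<lambda>n. innov_sum t (n\<^sup>2) w / real (n\<^sup>2)) \<longlonglongrightarrow> 0"
      by (rule tendsto_rabs_zero_cancel)
    then show "(\<lambda>n. innov_sum t n w / real n) \<longlonglongrightarrow> 0"
      using abs_innov_le[of t _ w]
      by (intro tendsto_of_square_subsequence) (auto simp: innov_sum_def)
  qed
qed

definition occupation :: "nat \<Rightarrow> 'w \<Rightarrow> 's \<Rightarrow> real" where
  "occupation n w s = (\<Sum>k=1..n. of_bool (Y k w = s)) / real n"

lemma sum_occupation:
  assumes "w \<in> space P"
  shows "(\<Sum>s\<in>S. occupation n w s * f s) = (\<Sum>k=1..n. f (Y k w)) / real n"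
proof -
  have "(\<Sum>s\<in>S. occupation n w s * f s)
      = (\<Sum>k=1..n. \<Sum>s\<in>S. of_bool (Y k w = s) * f s) / real n"
    unfolding occupation_def
    by (subst sum.swap) (simp add: sum_divide_distrib sum_distrib_right)
  also have "(\<Sum>k=1..n. \<Sum>s\<in>S. of_bool (Y k w = s) * f s) = (\<Sum>k=1..n. f (Y k w))"
  proof (intro sum.cong refl)
    fix k assume "k \<in> {1..n}"
    then have "Y k w \<in> S" using state_in[OF _ assms] by simp
    moreover have "(\<Sum>s\<in>S. of_bool (Y k w = s) * f s) = (\<Sum>s\<in>S. if s = Y k w then f s else 0)"
      by (intro sum.cong) auto
    ultimately show "(\<Sum>s\<in>S. of_bool (Y k w = s) * f s) = f (Y k w)"
      using finite_states by simp
  qed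
  finally show ?thesis .
qed

text \<open>
  Replacing the visits at times \<open>2, \<dots>, n + 1\<close> counted by the innovations by those at times
  \<open>1, \<dots>, n\<close> costs only the two boundary terms, so the occupation measure fails to be invariant
  by an average of innovations up to an error of order \<open>1 / n\<close>.
\<close>

lemma occupation_defect:
  assumes w: "w \<in> space P" and n: "n \<ge> 1"
  shows "occupation n w t - (\<Sum>s\<in>S. occupation n w s * pmf (p s) t)
    = innov_sum t n w / n - (of_bool (Y (Suc n) w = t) - of_bool (Y 1 w = t)) / n"
proof -
  have "innov_sum t n w = (\<Sum>k=1..n. of_bool (Y (Suc k) w = t)) - (\<Sum>k=1..n. pmf (p (Y k w)) t)"
    by (simp add: innov_sum_def innov_def sum_subtractf)
  also have "(\<Sum>k=1..n. of_bool (Y (Suc k) w = t) :: real)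
      = (\<Sum>k=1..n. of_bool (Y k w = t)) + of_bool (Y (Suc n) w = t) - of_bool (Y 1 w = t)"
    by (induction n) auto
  finally have innov: "innov_sum t n w = (\<Sum>k=1..n. of_bool (Y k w = t))
      + of_bool (Y (Suc n) w = t) - of_bool (Y 1 w = t) - (\<Sum>k=1..n. pmf (p (Y k w)) t)" .
  show ?thesis
    unfolding sum_occupation[OF w]
    unfolding occupation_def innov diff_divide_distrib add_divide_distrib by simp
qed

theorem ergodic_theorem:
  assumes irr: "irreducible_kernel S p"
    and \<mu>: "invariant_on S p \<mu>" "\<And>s. s \<in> S \<Longrightarrow> \<mu> s > 0" "sum \<mu> S = 1"
  shows "AE w in P. \<forall>f. (\<lambda>n. (\<Sum>k=1..n. f (Y k w)) / real n) \<longlonglongrightarrow> (\<Sum>s\<in>S. \<mu> s * f s)"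
proof -
  have "AE w in P. \<forall>t\<in>S. (\<lambda>n. innov_sum t n w / real n) \<longlonglongrightarrow> 0"
    using innov_average_tendsto_0 by (intro AE_finite_allI finite_states)
  then show ?thesis
  proof (rule AE_mp, intro AE_I2 impI allI)
    fix w and f :: "'s \<Rightarrow> real"
    assume w: "w \<in> space P" and lim: "\<forall>t\<in>S. (\<lambda>n. innov_sum t n w / real n) \<longlonglongrightarrow> 0"
    have "(\<lambda>n. occupation n w t) \<longlonglongrightarrow> \<mu> t" if t: "t \<in> S" for t
    proof (rule asymptotically_invariant_tendsto[OF finite_states irr \<mu> _ _ _ t])
      fix n s
      have "(\<Sum>k=1..n. of_bool (Y k w = s)) \<le> (\<Sum>k=1..n. 1 :: real)"
        by (intro sum_mono) auto
      moreover have "(\<Sum>k=1..n. of_bool (Y k w = s) :: real) \<ge> 0" by (intro sum_nonneg) auto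
      ultimately show "\<bar>occupation n w s\<bar> \<le> 1"
        by (auto simp: occupation_def divide_le_eq_1)
    next
      have "\<forall>\<^sub>F n in sequentially. (\<Sum>s\<in>S. occupation n w s) = 1"
        using eventually_ge_at_top[of 1]
        by eventually_elim (use sum_occupation[OF w, of _ "\<lambda>_. 1"] in simp)
      then show "(\<lambda>n. \<Sum>s\<in>S. occupation n w s) \<longlonglongrightarrow> 1" by (rule tendsto_eventually)
    next
      fix u assume u: "u \<in> S"
      let ?b = "\<lambda>n. of_bool (Y (Suc n) w = u) - of_bool (Y 1 w = u) :: real"
      have "(\<lambda>n. ?b n / real n) \<longlonglongrightarrow> 0"
      proof (rule Lim_null_comparison)
        show "\<forall>\<^sub>F n in sequentially. norm (?b n / real n) \<le> 1 / real n"
          by (intro always_eventually) (auto simp: divide_right_mono)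
        show "(\<lambda>n. 1 / real n) \<longlonglongrightarrow> 0" by (rule lim_const_over_n)
      qed
      then have "(\<lambda>n. innov_sum u n w / n - ?b n / n) \<longlonglongrightarrow> 0 - 0"
        using lim u by (intro tendsto_diff) auto
      then have "(\<lambda>n. innov_sum u n w / n - ?b n / n) \<longlonglongrightarrow> 0" by simp
      moreover have "\<forall>\<^sub>F n in sequentially. innov_sum u n w / n - ?b n / n
          = occupation n w u - (\<Sum>s\<in>S. occupation n w s * pmf (p s) u)"
        using eventually_ge_at_top[of 1]
        by eventually_elim (simp add: occupation_defect[OF w])
      ultimately show "(\<lambda>n. occupation n w u - (\<Sum>s\<in>S. occupation n w s * pmf (p s) u)) \<longlonglongrightarrow> 0"
        by (rule Lim_transform_eventually)
    qed
    then have "(\<lambda>n. \<Sum>s\<in>S. occupation n w s * f s) \<longlonglongrightarrow> (\<Sum>s\<in>S. \<mu> s * f s)"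
      by (intro tendsto_intros) auto
    then show "(\<lambda>n. (\<Sum>k=1..n. f (Y k w)) / real n) \<longlonglongrightarrow> (\<Sum>s\<in>S. \<mu> s * f s)"
      by (simp add: sum_occupation[OF w])
  qed
qed

end

section \<open>Correlations of the Ising model on the cycle\<close>

lemma spin_config_values:
  assumes "\<sigma> \<in> spin_configs N"
  shows spin_values: "i < N \<Longrightarrow> \<sigma> i = -1 \<or> \<sigma> i = 1"
    and spin_square: "i < N \<Longrightarrow> \<sigma> i * \<sigma> i = 1"
    and spin_product: "i < N \<Longrightarrow> j < N \<Longrightarrow> \<sigma> i * \<sigma> j = -1 \<or> \<sigma> i * \<sigma> j = 1"
proof -
  show v: "\<sigma> i = -1 \<or> \<sigma> i = 1" if "i < N" for i
    using assms that by (auto simp: spin_configs_def PiE_def Pi_def)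
  show "i < N \<Longrightarrow> \<sigma> i * \<sigma> i = 1" using v[of i] by auto
  show "i < N \<Longrightarrow> j < N \<Longrightarrow> \<sigma> i * \<sigma> j = -1 \<or> \<sigma> i * \<sigma> j = 1" using v[of i] v[of j] by auto
qed

lemma finite_spin_configs [simp]: "finite (spin_configs N)"
  by (simp add: spin_configs_def finite_PiE)

lemma spin_configs_nonempty: "spin_configs N \<noteq> {}"
  by (simp add: spin_configs_def PiE_eq_empty_iff)

definition ising_weight :: "real \<Rightarrow> nat \<Rightarrow> (nat \<Rightarrow> real) \<Rightarrow> real" where
  "ising_weight J N \<sigma> = (\<Prod>e<N. exp (J * (\<sigma> e * \<sigma> (Suc e mod N))))"

definition ising_gibbs :: "real \<Rightarrow> nat \<Rightarrow> (nat \<Rightarrow> real) \<Rightarrow> real" where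
  "ising_gibbs J N \<sigma> = ising_weight J N \<sigma> / (\<Sum>\<tau>\<in>spin_configs N. ising_weight J N \<tau>)"

definition ising_corr :: "real \<Rightarrow> nat \<Rightarrow> nat \<Rightarrow> nat \<Rightarrow> real" where
  "ising_corr J N i j = (\<Sum>\<sigma>\<in>spin_configs N. ising_gibbs J N \<sigma> * (\<sigma> i * \<sigma> j))"

lemma ising_weight_pos: "ising_weight J N \<sigma> > 0"
  by (simp add: ising_weight_def prod_pos)

lemma partition_function_pos: "(\<Sum>\<tau>\<in>spin_configs N. ising_weight J N \<tau>) > 0"
  by (simp add: sum_pos ising_weight_pos spin_configs_nonempty)

lemma ising_gibbs_pos: "ising_gibbs J N \<sigma> > 0"
  by (simp add: ising_gibbs_def ising_weight_pos partition_function_pos)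

lemma sum_ising_gibbs: "(\<Sum>\<sigma>\<in>spin_configs N. ising_gibbs J N \<sigma>) = 1"
  using partition_function_pos[of J N]
  by (simp add: ising_gibbs_def sum_divide_distrib[symmetric])

lemma sum_spin_configs_Suc:
  "(\<Sum>\<sigma>\<in>spin_configs (Suc n). f \<sigma>) = (\<Sum>\<sigma>\<in>spin_configs n. \<Sum>z\<in>{-1, 1}. f (\<sigma>(n := z)))"
  for f :: "(nat \<Rightarrow> real) \<Rightarrow> real"
proof -
  have "spin_configs (Suc n) = (\<lambda>(z, \<sigma>). \<sigma>(n := z)) ` ({-1, 1} \<times> spin_configs n)"
    by (simp add: spin_configs_def lessThan_Suc PiE_insert_eq)
  moreover have "inj_on (\<lambda>(z, \<sigma>). \<sigma>(n := z)) ({-1, 1} \<times> spin_configs n)"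
    unfolding spin_configs_def by (rule inj_combinator) simp
  ultimately have "(\<Sum>\<sigma>\<in>spin_configs (Suc n). f \<sigma>)
      = (\<Sum>(z, \<sigma>)\<in>{-1, 1} \<times> spin_configs n. f (\<sigma>(n := z)))"
    by (simp add: sum.reindex case_prod_unfold)
  then show ?thesis
    by (simp add: sum.cartesian_product[symmetric] sum.swap[of _ "{-1, 1}"] del: sum.insert)
qed

text \<open>
  Summing out an inner spin multiplies the coefficients:
  \<open>\<Sum>\<^sub>y (A + B x y) (a + b y z) = 2 (A a + B b x z)\<close>. The endpoint spins stay free through the test
  function \<open>h\<close>, which the induction has to vary. The factor \<open>2\<^sup>n / 2\<close> is correct also for
  \<open>n = 0\<close>, where \<open>(1 + x y) / 2\<close> is the indicator of \<open>x = y\<close>.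
\<close>

lemma sum_spin_path:
  "(\<Sum>\<sigma>\<in>spin_configs (Suc n). h (\<sigma> 0) (\<sigma> n) * (\<Prod>e<n. a e + b e * (\<sigma> e * \<sigma> (Suc e))))
     = 2 ^ n / 2 * (\<Sum>x\<in>{-1, 1}. \<Sum>y\<in>{-1, 1}. h x y * ((\<Prod>e<n. a e) + (\<Prod>e<n. b e) * (x * y)))"
  for h :: "real \<Rightarrow> real \<Rightarrow> real"
proof (induction n arbitrary: h)
  case 0
  have "spin_configs 0 = {\<lambda>_. undefined}" by (simp add: spin_configs_def)
  then show ?case by (simp add: sum_spin_configs_Suc)
next
  case (Suc n)
  let ?p = "\<lambda>\<sigma>. \<Prod>e<n. a e + b e * (\<sigma> e * \<sigma> (Suc e) :: real)"
  let ?h = "\<lambda>x y. \<Sum>z\<in>{-1, 1}. h x z * (a n + b n * (y * z))"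
  have "(\<Sum>\<sigma>\<in>spin_configs (Suc (Suc n)).
      h (\<sigma> 0) (\<sigma> (Suc n)) * (\<Prod>e<Suc n. a e + b e * (\<sigma> e * \<sigma> (Suc e))))
    = (\<Sum>\<sigma>\<in>spin_configs (Suc n). \<Sum>z\<in>{-1, 1}.
        h (\<sigma> 0) z * ((a n + b n * (\<sigma> n * z)) * ?p \<sigma>))"
    unfolding sum_spin_configs_Suc[of _ "Suc n"] prod.lessThan_Suc
  proof (intro sum.cong refl, goal_cases)
    case (1 \<sigma> z)
    have "?p (\<sigma>(Suc n := z)) = ?p \<sigma>" by (intro prod.cong) auto
    then show ?case by (simp add: mult_ac)
  qed
  also have "\<dots> = (\<Sum>\<sigma>\<in>spin_configs (Suc n). ?h (\<sigma> 0) (\<sigma> n) * ?p \<sigma>)"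
    by (simp add: sum_distrib_right algebra_simps)
  also have "\<dots> = 2 ^ n / 2 * (\<Sum>x\<in>{-1, 1}. \<Sum>y\<in>{-1, 1}.
      ?h x y * ((\<Prod>e<n. a e) + (\<Prod>e<n. b e) * (x * y)))"
    by (rule Suc)
  also have "\<dots> = 2 ^ Suc n / 2 * (\<Sum>x\<in>{-1, 1}. \<Sum>y\<in>{-1, 1}.
      h x y * ((\<Prod>e<Suc n. a e) + (\<Prod>e<Suc n. b e) * (x * y)))"
    by (simp add: algebra_simps)
  finally show ?case .
qed

text \<open>
  The closing edge of the cycle is the test function of the path formed by the other edges.
\<close>

lemma sum_spin_cycle:
  assumes "N \<ge> 1"
  shows "(\<Sum>\<sigma>\<in>spin_configs N. \<Prod>e<N. a e + b e * (\<sigma> e * \<sigma> (Suc e mod N)))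
    = 2 ^ N * ((\<Prod>e<N. a e) + (\<Prod>e<N. b e) :: real)"
proof -
  obtain n where N: "N = Suc n" using assms by (cases N) auto
  have "(\<Prod>e<N. a e + b e * (\<sigma> e * \<sigma> (Suc e mod N)))
      = (a n + b n * (\<sigma> n * \<sigma> 0)) * (\<Prod>e<n. a e + b e * (\<sigma> e * \<sigma> (Suc e)))"
    for \<sigma> :: "nat \<Rightarrow> real"
    unfolding N prod.lessThan_Suc by (simp add: mult.commute)
  then show ?thesis
    using sum_spin_path[of "\<lambda>x y. a n + b n * (y * x)" n a b]
    by (simp add: N algebra_simps)
qed

text \<open>
  Makes the Boltzmann factor of an edge affine in the product of its spins, which is the form
  summed in \<open>sum_spin_cycle\<close>.
\<close>

lemma exp_mult_spin:
  "x = -1 \<or> x = 1 \<Longrightarrow> exp (J * x) = cosh J + sinh J * x" for x J :: real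
  by (auto simp: cosh_def sinh_def field_simps)

lemma spin_product_telescope:
  assumes \<sigma>: "\<sigma> \<in> spin_configs N" and "i \<le> j" "j < N"
  shows "\<sigma> i * \<sigma> j = (\<Prod>e\<in>{i..<j}. \<sigma> e * \<sigma> (Suc e mod N))"
  using assms(2,3)
proof (induction j rule: dec_induct)
  case base
  then show ?case using spin_square[OF \<sigma>, of i] by simp
next
  case (step j)
  have "(\<Prod>e\<in>{i..<Suc j}. \<sigma> e * \<sigma> (Suc e mod N)) = (\<sigma> i * \<sigma> j) * (\<sigma> j * \<sigma> (Suc j))"
    using step by (simp add: prod.atLeastLessThan_Suc)
  also have "\<dots> = (\<sigma> j * \<sigma> j) * (\<sigma> i * \<sigma> (Suc j))"
    by (simp only: mult_ac)
  also have "\<dots> = \<sigma> i * \<sigma> (Suc j)"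
    using spin_square[OF \<sigma>, of j] step.prems by simp
  finally show ?case by simp
qed

text \<open>
  By \<open>spin_product_telescope\<close>, inserting \<open>\<sigma>\<^sub>i \<sigma>\<^sub>j\<close> multiplies each edge factor
  \<open>c + s x\<close> between \<open>i\<close> and \<open>j\<close> by \<open>x = \<plusminus>1\<close>, which exchanges the roles of \<open>c\<close> and \<open>s\<close> there.
  Numerator and partition function are then both instances of \<open>sum_spin_cycle\<close>.
\<close>

lemma ising_corr_eq:
  assumes "i \<le> j" "j < N"
  shows "ising_corr J N i j
    = (sinh J ^ (j - i) * cosh J ^ (N - (j - i)) + cosh J ^ (j - i) * sinh J ^ (N - (j - i)))
      / (cosh J ^ N + sinh J ^ N)"
proof -
  let ?c = "cosh J" and ?s = "sinh J"
  have N: "N \<ge> 1" using assms by simp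
  have split: "(\<Prod>e<N. if e \<in> {i..<j} then p else q) = p ^ (j - i) * q ^ (N - (j - i))"
    for p q :: real
  proof -
    have "{..<N} \<inter> {e. i \<le> e \<and> e < j} = {i..<j}"
      "{..<N} \<inter> - {e. i \<le> e \<and> e < j} = {..<N} - {i..<j}"
      using assms by auto
    moreover have "card ({..<N} - {i..<j}) = N - (j - i)"
      using assms by (subst card_Diff_subset) auto
    ultimately show ?thesis using prod.If_cases[of "{..<N}" "\<lambda>e. e \<in> {i..<j}" "\<lambda>_. p" "\<lambda>_. q"]
      by simp
  qed
  have weight: "ising_weight J N \<sigma> = (\<Prod>e<N. ?c + ?s * (\<sigma> e * \<sigma> (Suc e mod N)))"
    if "\<sigma> \<in> spin_configs N" for \<sigma>
    unfolding ising_weight_def using spin_product[OF that] N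
    by (intro prod.cong refl exp_mult_spin) auto
  have "(\<Sum>\<sigma>\<in>spin_configs N. ising_weight J N \<sigma>) = 2 ^ N * (?c ^ N + ?s ^ N)"
    using sum_spin_cycle[OF N, of "\<lambda>_. ?c" "\<lambda>_. ?s"] by (simp add: weight)
  moreover have "(\<Sum>\<sigma>\<in>spin_configs N. ising_weight J N \<sigma> * (\<sigma> i * \<sigma> j))
      = 2 ^ N * (?s ^ (j - i) * ?c ^ (N - (j - i)) + ?c ^ (j - i) * ?s ^ (N - (j - i)))"
  proof -
    let ?a = "\<lambda>e. if e \<in> {i..<j} then ?s else ?c"
    let ?b = "\<lambda>e. if e \<in> {i..<j} then ?c else ?s"
    have "ising_weight J N \<sigma> * (\<sigma> i * \<sigma> j)
        = (\<Prod>e<N. ?a e + ?b e * (\<sigma> e * \<sigma> (Suc e mod N)))" if \<sigma>: "\<sigma> \<in> spin_configs N" for \<sigma>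
    proof -
      let ?x = "\<lambda>e. \<sigma> e * \<sigma> (Suc e mod N)"
      have "{..<N} \<inter> {i..<j} = {i..<j}" using assms by auto
      then have "\<sigma> i * \<sigma> j = (\<Prod>e<N. if e \<in> {i..<j} then ?x e else 1)"
        using spin_product_telescope[OF \<sigma> assms] prod.inter_restrict[of "{..<N}" ?x "{i..<j}"]
        by simp
      then have "ising_weight J N \<sigma> * (\<sigma> i * \<sigma> j)
          = (\<Prod>e<N. (?c + ?s * ?x e) * (if e \<in> {i..<j} then ?x e else 1))"
        by (simp add: weight[OF \<sigma>] prod.distrib)
      also have "\<dots> = (\<Prod>e<N. ?a e + ?b e * ?x e)"
      proof (intro prod.cong refl)
        fix e assume "e \<in> {..<N}"
        then have "?x e = -1 \<or> ?x e = 1" using spin_product[OF \<sigma>, of e "Suc e mod N"] N by auto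
        then show "(?c + ?s * ?x e) * (if e \<in> {i..<j} then ?x e else 1) = ?a e + ?b e * ?x e"
          by auto
      qed
      finally show ?thesis .
    qed
    then have "(\<Sum>\<sigma>\<in>spin_configs N. ising_weight J N \<sigma> * (\<sigma> i * \<sigma> j))
        = 2 ^ N * ((\<Prod>e<N. ?a e) + (\<Prod>e<N. ?b e))"
      using sum_spin_cycle[OF N, of ?a ?b] by simp
    then show ?thesis by (simp only: split)
  qed
  ultimately show ?thesis
    by (simp add: ising_corr_def ising_gibbs_def sum_divide_distrib[symmetric])
qed

lemma ising_corr_commute: "ising_corr J N i j = ising_corr J N j i"
  by (simp add: ising_corr_def mult.commute)

lemma tanh_real_unit: "J \<ge> 0 \<Longrightarrow> 0 \<le> tanh J \<and> tanh J < 1" for J :: real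
  using tanh_real_lt_1[of J] by simp

text \<open>
  The two terms correspond to the two arcs of the cycle that join \<open>i\<close> and \<open>j\<close>.
\<close>

lemma ising_corr_bound:
  assumes J: "J \<ge> 0" and ij: "i \<le> j" "j < N"
  shows "\<bar>ising_corr J N i j\<bar> \<le> tanh J ^ (j - i) + tanh J ^ (N - (j - i))"
proof -
  define d where "d = j - i"
  define t where "t = tanh J"
  have d: "d \<le> N" using ij by (simp add: d_def)
  have c: "cosh J > 0" by (rule cosh_real_pos)
  have s: "sinh J = t * cosh J" using c by (simp add: t_def tanh_def)
  have t: "0 \<le> t" "t < 1" using tanh_real_unit[OF J] by (auto simp: t_def)
  have cN: "cosh J ^ N = cosh J ^ d * cosh J ^ (N - d)"
    using d by (simp add: power_add[symmetric])
  have "ising_corr J N i j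
      = (cosh J ^ N * (t ^ d + t ^ (N - d))) / (cosh J ^ N * (1 + t ^ N))"
    unfolding ising_corr_eq[OF ij] d_def[symmetric] s
    by (simp add: power_mult_distrib cN algebra_simps)
  also have "\<dots> = (t ^ d + t ^ (N - d)) / (1 + t ^ N)" using c by simp
  finally have eq: "ising_corr J N i j = (t ^ d + t ^ (N - d)) / (1 + t ^ N)" .
  have pos: "0 \<le> t ^ d + t ^ (N - d)" "0 \<le> t ^ N" using t by auto
  have "(t ^ d + t ^ (N - d)) / (1 + t ^ N) \<le> (t ^ d + t ^ (N - d)) / 1"
    using pos by (intro divide_left_mono) auto
  then show ?thesis using pos by (simp add: eq d_def[symmetric] t_def[symmetric])
qed

lemma sum_geometric_inj_le:
  fixes t :: real
  assumes t: "0 \<le> t" "t < 1" and "finite A" "inj_on g A"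
  shows "(\<Sum>j\<in>A. t ^ g j) \<le> 1 / (1 - t)"
proof -
  have "(\<Sum>j\<in>A. t ^ g j) = (\<Sum>k\<in>g ` A. t ^ k)" by (simp add: sum.reindex assms)
  also have "\<dots> \<le> (\<Sum>k. t ^ k)"
    using t assms by (intro sum_le_suminf) (auto intro: summable_geometric)
  also have "\<dots> = 1 / (1 - t)" using t by (simp add: suminf_geometric)
  finally show ?thesis .
qed

text \<open>
  Four geometric series: one for each arc, for the sites on either side of \<open>i\<close>.
\<close>

lemma sum_ising_corr_le:
  assumes J: "J \<ge> 0" and i: "i < N"
  shows "(\<Sum>j<N. \<bar>ising_corr J N i j\<bar>) \<le> 4 / (1 - tanh J)"
proof -
  define t where "t = tanh J"
  have t: "0 \<le> t" "t < 1" using tanh_real_unit[OF J] by (auto simp: t_def)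
  have "{..<N} = {..<i} \<union> {i..<N}" using i by auto
  then have "(\<Sum>j<N. \<bar>ising_corr J N i j\<bar>)
      = (\<Sum>j<i. \<bar>ising_corr J N j i\<bar>) + (\<Sum>j\<in>{i..<N}. \<bar>ising_corr J N i j\<bar>)"
    by (simp add: sum.union_disjoint ivl_disj_int ising_corr_commute[of J N i])
  also have "\<dots> \<le> (\<Sum>j<i. t ^ (i - j) + t ^ (N - (i - j)))
      + (\<Sum>j\<in>{i..<N}. t ^ (j - i) + t ^ (N - (j - i)))"
    unfolding t_def using i by (intro add_mono sum_mono ising_corr_bound[OF J]) auto
  also have "\<dots> = (\<Sum>j<i. t ^ (i - j)) + (\<Sum>j<i. t ^ (N - (i - j)))
      + ((\<Sum>j\<in>{i..<N}. t ^ (j - i)) + (\<Sum>j\<in>{i..<N}. t ^ (N - (j - i))))"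
    by (simp add: sum.distrib)
  also have "\<dots> \<le> 1 / (1 - t) + 1 / (1 - t) + (1 / (1 - t) + 1 / (1 - t))"
    using i by (intro add_mono sum_geometric_inj_le t) (auto simp: inj_on_def)
  finally show ?thesis by (simp add: t_def)
qed

section \<open>Irreducibility and invariant measure of the Wolff dynamics\<close>

lemma flip_spins_involution: "flip_spins C (flip_spins C \<sigma>) = \<sigma>"
  by (auto simp: flip_spins_def)

lemma flip_spins_in_spin_configs:
  assumes "\<sigma> \<in> spin_configs N" "C \<subseteq> {..<N}"
  shows "flip_spins C \<sigma> \<in> spin_configs N"
  using assms by (auto simp: flip_spins_def spin_configs_def PiE_def Pi_def extensional_def)

lemma open_cluster_subset:
  assumes "i \<in> {..<N}"
  shows "open_cluster N op i \<subseteq> {..<N}"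
proof
  fix j assume "j \<in> open_cluster N op i"
  then have "(i, j) \<in> (open_adjacency N op)\<^sup>*" by (simp add: open_cluster_def)
  then show "j \<in> {..<N}"
  proof (induction rule: rtrancl_induct)
    case (step j k)
    then obtain e where "e < N" "{j, k} = {e, Suc e mod N}" by (auto simp: open_adjacency_def)
    moreover have "Suc e mod N < N" using \<open>e < N\<close> by simp
    ultimately show ?case by (metis insert_iff lessThan_iff singletonD)
  qed (use assms in auto)
qed

lemma open_edge_in_cluster_iff:
  assumes "e < N" "op e"
  shows "e \<in> open_cluster N op i \<longleftrightarrow> Suc e mod N \<in> open_cluster N op i"
proof -
  have "(e, Suc e mod N) \<in> open_adjacency N op" "(Suc e mod N, e) \<in> open_adjacency N op"
    using assms by (auto simp: open_adjacency_def)
  then show ?thesis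
    unfolding open_cluster_def mem_Collect_eq by (meson rtrancl.rtrancl_into_rtrancl)
qed

definition wolff_edge_pmf :: "real \<Rightarrow> nat \<Rightarrow> (nat \<Rightarrow> real) \<Rightarrow> nat \<Rightarrow> bool pmf" where
  "wolff_edge_pmf J N \<sigma> e = bernoulli_pmf (1 - exp (- J * (1 + \<sigma> e * \<sigma> (Suc e mod N))))"

lemma pmf_wolff_edge:
  assumes "J \<ge> 0" "\<sigma> \<in> spin_configs N" "e < N"
  shows "pmf (wolff_edge_pmf J N \<sigma> e) True = 1 - exp (- J * (1 + \<sigma> e * \<sigma> (Suc e mod N)))"
    and "pmf (wolff_edge_pmf J N \<sigma> e) False = exp (- J * (1 + \<sigma> e * \<sigma> (Suc e mod N)))"
proof -
  have "\<sigma> e * \<sigma> (Suc e mod N) = -1 \<or> \<sigma> e * \<sigma> (Suc e mod N) = 1"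
    using spin_product[OF assms(2), of e "Suc e mod N"] assms(3) by simp
  then have "0 \<le> 1 - exp (- J * (1 + \<sigma> e * \<sigma> (Suc e mod N)))"
    "1 - exp (- J * (1 + \<sigma> e * \<sigma> (Suc e mod N))) \<le> 1"
    using assms(1) by auto
  then show "pmf (wolff_edge_pmf J N \<sigma> e) True = 1 - exp (- J * (1 + \<sigma> e * \<sigma> (Suc e mod N)))"
    and "pmf (wolff_edge_pmf J N \<sigma> e) False = exp (- J * (1 + \<sigma> e * \<sigma> (Suc e mod N)))"
    by (simp_all add: wolff_edge_pmf_def)
qed

text \<open>
  The cluster flip changes the product of the spins of an edge only if exactly one endpoint lies
  in the cluster. Such an edge must be closed, and the probability of that compensates the change of
  its Gibbs factor.
\<close>

lemma edge_balance:
  fixes op :: "nat \<Rightarrow> bool"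
  assumes J: "J \<ge> 0" and \<sigma>: "\<sigma> \<in> spin_configs N" and i: "i \<in> {..<N}" and e: "e < N"
  defines "C \<equiv> open_cluster N op i"
  defines "\<tau> \<equiv> flip_spins C \<sigma>"
  shows "exp (J * (\<sigma> e * \<sigma> (Suc e mod N))) * pmf (wolff_edge_pmf J N \<sigma> e) (op e)
    = exp (J * (\<tau> e * \<tau> (Suc e mod N))) * pmf (wolff_edge_pmf J N \<tau> e) (op e)"
proof (cases "e \<in> C \<longleftrightarrow> Suc e mod N \<in> C")
  case True
  then have "\<tau> e * \<tau> (Suc e mod N) = \<sigma> e * \<sigma> (Suc e mod N)"
    by (auto simp: \<tau>_def flip_spins_def)
  then show ?thesis by (simp add: wolff_edge_pmf_def)
next
  case False
  then have "\<not> op e" using open_edge_in_cluster_iff[OF e] by (auto simp: C_def)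
  moreover have "\<tau> \<in> spin_configs N"
    unfolding \<tau>_def C_def by (intro flip_spins_in_spin_configs \<sigma> open_cluster_subset i)
  \<comment> \<open>On either side the two exponentials multiply to the spin-free constant \<open>exp (- J)\<close>.\<close>
  ultimately show ?thesis
    using \<sigma> by (simp add: pmf_wolff_edge[OF J _ e] exp_add[symmetric] algebra_simps)
qed

definition edge_configs :: "nat \<Rightarrow> (nat \<Rightarrow> bool) set" where
  "edge_configs N = PiE_dflt {..<N} False (\<lambda>_. UNIV)"

definition edge_prob :: "real \<Rightarrow> nat \<Rightarrow> (nat \<Rightarrow> real) \<Rightarrow> (nat \<Rightarrow> bool) \<Rightarrow> real" where
  "edge_prob J N \<sigma> op = pmf (Pi_pmf {..<N} False (wolff_edge_pmf J N \<sigma>)) op"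

lemma finite_edge_configs [simp]: "finite (edge_configs N)"
  by (simp add: edge_configs_def finite_PiE_dflt)

lemma set_edge_pmf: "set_pmf (Pi_pmf {..<N} False p) \<subseteq> edge_configs N"
  using set_Pi_pmf_subset[of "{..<N}" False p] by (auto simp: edge_configs_def PiE_dflt_def)

lemma sum_edge_prob: "(\<Sum>op\<in>edge_configs N. edge_prob J N \<sigma> op) = 1"
  unfolding edge_prob_def by (intro sum_pmf_eq_1 set_edge_pmf) simp

lemma edge_config_balance:
  assumes J: "J \<ge> 0" and \<sigma>: "\<sigma> \<in> spin_configs N" and i: "i \<in> {..<N}"
    and op: "op \<in> edge_configs N"
  defines "\<tau> \<equiv> flip_spins (open_cluster N op i) \<sigma>"
  shows "ising_weight J N \<sigma> * edge_prob J N \<sigma> op = ising_weight J N \<tau> * edge_prob J N \<tau> op"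
proof -
  have "edge_prob J N \<rho> op = (\<Prod>e<N. pmf (wolff_edge_pmf J N \<rho> e) (op e))" for \<rho>
    unfolding edge_prob_def using op by (intro pmf_Pi') (auto simp: edge_configs_def PiE_dflt_def)
  then show ?thesis
    unfolding ising_weight_def \<tau>_def
    by (simp only: prod.distrib[symmetric]) (intro prod.cong refl edge_balance[OF J \<sigma> i], simp)
qed

lemma pmf_wolff_step:
  assumes "N \<ge> 1"
  shows "pmf (wolff_step J N \<sigma>) \<tau> = (\<Sum>i<N. \<Sum>op\<in>edge_configs N.
      edge_prob J N \<sigma> op * of_bool (flip_spins (open_cluster N op i) \<sigma> = \<tau>)) / N"
proof -
  have "pmf (bind_pmf (Pi_pmf {..<N} False (wolff_edge_pmf J N \<sigma>))
        (\<lambda>op. return_pmf (flip_spins (open_cluster N op i) \<sigma>))) \<tau>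
      = (\<Sum>op\<in>edge_configs N.
          edge_prob J N \<sigma> op * of_bool (flip_spins (open_cluster N op i) \<sigma> = \<tau>))" for i
    unfolding pmf_bind
    using set_edge_pmf
    by (subst integral_measure_pmf[where A = "edge_configs N"])
      (auto simp: edge_prob_def indicator_def intro!: sum.cong)
  moreover have "wolff_step J N \<sigma> = bind_pmf (pmf_of_set {..<N}) (\<lambda>i.
      bind_pmf (Pi_pmf {..<N} False (wolff_edge_pmf J N \<sigma>))
        (\<lambda>op. return_pmf (flip_spins (open_cluster N op i) \<sigma>)))"
    by (simp add: wolff_step_def wolff_edge_pmf_def[abs_def])
  moreover have "{..<N} \<noteq> {}" using assms by (simp add: lessThan_empty_iff)
  ultimately show ?thesis by (simp add: pmf_bind_pmf_of_set)
qed

text \<open>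
  For a fixed starting site and fixed open edges, \<open>\<tau>\<close> has exactly one predecessor, its own cluster
  flip. By \<open>edge_config_balance\<close> this predecessor contributes the Gibbs weight of \<open>\<tau>\<close> times
  the probability of the open edges under \<open>\<tau>\<close>, and these probabilities add up to 1.
\<close>

lemma ising_gibbs_invariant:
  assumes N: "N \<ge> 1" and J: "J \<ge> 0" and \<tau>: "\<tau> \<in> spin_configs N"
  shows "(\<Sum>\<sigma>\<in>spin_configs N. ising_gibbs J N \<sigma> * pmf (wolff_step J N \<sigma>) \<tau>) = ising_gibbs J N \<tau>"
proof -
  let ?S = "spin_configs N" and ?E = "edge_configs N"
  let ?f = "\<lambda>i op. flip_spins (open_cluster N op i)"
  have single: "(\<Sum>\<sigma>\<in>?S. ising_weight J N \<sigma> * edge_prob J N \<sigma> op * of_bool (?f i op \<sigma> = \<tau>))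
      = ising_weight J N \<tau> * edge_prob J N \<tau> op" if i: "i \<in> {..<N}" and op: "op \<in> ?E" for i op
  proof -
    have f\<tau>: "?f i op \<tau> \<in> ?S"
      by (intro flip_spins_in_spin_configs \<tau> open_cluster_subset i)
    have "(?f i op \<sigma> = \<tau>) = (\<sigma> = ?f i op \<tau>)" for \<sigma>
      using flip_spins_involution by metis
    then have "(\<Sum>\<sigma>\<in>?S. ising_weight J N \<sigma> * edge_prob J N \<sigma> op * of_bool (?f i op \<sigma> = \<tau>))
        = ising_weight J N (?f i op \<tau>) * edge_prob J N (?f i op \<tau>) op"
      using f\<tau> by (simp add: of_bool_def if_distrib cong: if_cong)
    then show ?thesis using edge_config_balance[OF J \<tau> i op] by simp
  qed
  have "(\<Sum>\<sigma>\<in>?S. ising_weight J N \<sigma> * pmf (wolff_step J N \<sigma>) \<tau>)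
      = (\<Sum>\<sigma>\<in>?S. \<Sum>i<N. \<Sum>op\<in>?E.
          ising_weight J N \<sigma> * edge_prob J N \<sigma> op * of_bool (?f i op \<sigma> = \<tau>)) / N"
    by (simp add: pmf_wolff_step[OF N] sum_divide_distrib sum_distrib_left mult.assoc
        del: sum_mult_of_bool_eq)
  also have "(\<Sum>\<sigma>\<in>?S. \<Sum>i<N. \<Sum>op\<in>?E.
          ising_weight J N \<sigma> * edge_prob J N \<sigma> op * of_bool (?f i op \<sigma> = \<tau>))
      = (\<Sum>i<N. \<Sum>op\<in>?E. \<Sum>\<sigma>\<in>?S.
          ising_weight J N \<sigma> * edge_prob J N \<sigma> op * of_bool (?f i op \<sigma> = \<tau>))"
    by (subst sum.swap, rule sum.cong, simp, rule sum.swap)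
  also have "\<dots> = (\<Sum>i<N. \<Sum>op\<in>?E. ising_weight J N \<tau> * edge_prob J N \<tau> op)"
    by (intro sum.cong refl single) auto
  also have "\<dots> = N * ising_weight J N \<tau>"
    by (simp add: sum_distrib_left[symmetric] sum_edge_prob)
  finally have "(\<Sum>\<sigma>\<in>?S. ising_weight J N \<sigma> * pmf (wolff_step J N \<sigma>) \<tau>) = ising_weight J N \<tau>"
    using N by simp
  then show ?thesis
    by (simp add: ising_gibbs_def sum_divide_distrib[symmetric])
qed

text \<open>
  All edges are closed with positive probability, and then the cluster is the starting site alone.
\<close>

lemma wolff_single_flip:
  assumes J: "J \<ge> 0" and \<sigma>: "\<sigma> \<in> spin_configs N" and i: "i < N"
  shows "pmf (wolff_step J N \<sigma>) (flip_spins {i} \<sigma>) > 0"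
proof -
  have "open_adjacency N (\<lambda>_. False) = {}" by (auto simp: open_adjacency_def)
  then have "open_cluster N (\<lambda>_. False) i = {i}" by (auto simp: open_cluster_def)
  moreover have "(\<lambda>_. False) \<in> set_pmf (Pi_pmf {..<N} False (wolff_edge_pmf J N \<sigma>))"
    by (subst set_Pi_pmf) (auto simp: PiE_dflt_def set_pmf_iff pmf_wolff_edge[OF J \<sigma>])
  moreover have "i \<in> set_pmf (pmf_of_set {..<N})" using i by (subst set_pmf_of_set) auto
  ultimately have "flip_spins {i} \<sigma> \<in> set_pmf (wolff_step J N \<sigma>)"
    unfolding wolff_step_def wolff_edge_pmf_def[symmetric, abs_def] set_bind_pmf UN_iff
    by (intro bexI[of _ i] bexI[of _ "\<lambda>_. False"]) (auto simp: wolff_edge_pmf_def[abs_def])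
  then show ?thesis by (simp add: pmf_positive_iff)
qed

text \<open>
  Flip the disagreeing sites one at a time.
\<close>

lemma wolff_irreducible:
  assumes J: "J \<ge> 0"
  shows "irreducible_kernel (spin_configs N) (wolff_step J N)"
proof -
  let ?R = "{(\<sigma>, \<tau>). \<sigma> \<in> spin_configs N \<and> \<tau> \<in> spin_configs N \<and> pmf (wolff_step J N \<sigma>) \<tau> > 0}"
  have "(\<sigma>, \<tau>) \<in> ?R\<^sup>*"
    if "\<sigma> \<in> spin_configs N" "\<tau> \<in> spin_configs N" "card {i. i < N \<and> \<sigma> i \<noteq> \<tau> i} = n" for \<sigma> \<tau> n
    using that
  proof (induction n arbitrary: \<sigma>)
    case 0
    have "\<sigma> = \<tau>"
      using 0 unfolding spin_configs_def by (intro PiE_ext[of \<sigma> "{..<N}" _ \<tau>]) auto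
    then show ?case by simp
  next
    case (Suc n)
    then obtain i where i: "i < N" "\<sigma> i \<noteq> \<tau> i"
      by (metis (mono_tags, lifting) Collect_empty_eq card.empty nat.distinct(1))
    let ?\<sigma> = "flip_spins {i} \<sigma>"
    have \<sigma>': "?\<sigma> \<in> spin_configs N" using Suc i by (intro flip_spins_in_spin_configs) auto
    have "?\<sigma> i = \<tau> i"
      using spin_values[OF Suc.prems(1) i(1)] spin_values[OF Suc.prems(2) i(1)] i
      by (auto simp: flip_spins_def)
    then have "{k. k < N \<and> ?\<sigma> k \<noteq> \<tau> k} = {k. k < N \<and> \<sigma> k \<noteq> \<tau> k} - {i}"
      by (auto simp: flip_spins_def)
    then have "card {k. k < N \<and> ?\<sigma> k \<noteq> \<tau> k} = n" using Suc i by simp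
    then have "(?\<sigma>, \<tau>) \<in> ?R\<^sup>*" using Suc \<sigma>' by blast
    moreover have "(\<sigma>, ?\<sigma>) \<in> ?R"
      using wolff_single_flip[OF J Suc.prems(1) i(1)] Suc \<sigma>' by simp
    ultimately show ?case by (rule converse_rtrancl_into_rtrancl[rotated])
  qed
  then show ?thesis by (auto simp: irreducible_kernel_def)
qed

section \<open>The sample covariance matrix and its iterated limit\<close>

lemma psd_sample_cov: "psd_mat N (sample_cov N M y)"
proof -
  let ?c = "1 / (real M * real N)"
  have "quad_form (sample_cov N M y) x = ?c * (\<Sum>k=1..M. (\<Sum>i<N. x i * y k i)\<^sup>2)" for x
  proof -
    have "quad_form (sample_cov N M y) x
        = (\<Sum>i<N. \<Sum>j<N. ?c * (\<Sum>k=1..M. (x i * y k i) * (x j * y k j)))"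
      unfolding quad_form_def
      by (intro sum.cong) (auto simp: sample_cov_def sum_distrib_left sum_distrib_right mult_ac)
    also have "\<dots> = ?c * (\<Sum>i<N. \<Sum>j<N. \<Sum>k=1..M. (x i * y k i) * (x j * y k j))"
      by (simp only: sum_distrib_left)
    also have "(\<Sum>i<N. \<Sum>j<N. \<Sum>k=1..M. (x i * y k i) * (x j * y k j))
        = (\<Sum>i<N. \<Sum>k=1..M. \<Sum>j<N. (x i * y k i) * (x j * y k j))"
      by (intro sum.cong refl sum.swap)
    also have "\<dots> = (\<Sum>k=1..M. \<Sum>i<N. \<Sum>j<N. (x i * y k i) * (x j * y k j))"
      by (rule sum.swap)
    finally show ?thesis by (simp add: power2_eq_square sum_product)
  qed
  then have "quad_form (sample_cov N M y) x \<ge> 0" for x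
    by (simp add: sum_nonneg)
  moreover have "transpose_mat (sample_cov N M y) = sample_cov N M y"
    by (auto simp: sample_cov_def mult.commute intro!: eq_matI)
  ultimately show ?thesis by (simp add: psd_mat_def) (simp add: sample_cov_def)
qed

text \<open>
  The almost sure limit of the sample covariance matrix as \<open>M \<rightarrow> \<infinity>\<close>.
\<close>

definition ising_cov :: "real \<Rightarrow> nat \<Rightarrow> real mat" where
  "ising_cov J N = Matrix.mat N N (\<lambda>(i, j). ising_corr J N i j / N)"

lemma ising_cov_carrier [simp]: "ising_cov J N \<in> carrier_mat N N"
  by (simp add: ising_cov_def)

text \<open>
  The quadratic form at \<open>x\<close> is the Gibbs mean of \<open>(\<Sum>\<^sub>i x\<^sub>i \<sigma>\<^sub>i)\<^sup>2 / N\<close>.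
\<close>

lemma psd_ising_cov: "psd_mat N (ising_cov J N)"
proof -
  have "quad_form (ising_cov J N) x
      = (\<Sum>\<sigma>\<in>spin_configs N. ising_gibbs J N \<sigma> * (\<Sum>i<N. x i * \<sigma> i)\<^sup>2) / N" for x
  proof -
    have "quad_form (ising_cov J N) x = (\<Sum>i<N. \<Sum>j<N. \<Sum>\<sigma>\<in>spin_configs N.
        ising_gibbs J N \<sigma> * ((x i * \<sigma> i) * (x j * \<sigma> j)) / N)"
      unfolding quad_form_def
      by (intro sum.cong)
        (auto simp: ising_cov_def ising_corr_def sum_distrib_left sum_distrib_right
          sum_divide_distrib mult_ac)
    also have "\<dots> = (\<Sum>i<N. \<Sum>\<sigma>\<in>spin_configs N. \<Sum>j<N.
        ising_gibbs J N \<sigma> * ((x i * \<sigma> i) * (x j * \<sigma> j)) / N)"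
      by (intro sum.cong refl sum.swap)
    also have "\<dots> = (\<Sum>\<sigma>\<in>spin_configs N. \<Sum>i<N. \<Sum>j<N.
        ising_gibbs J N \<sigma> * ((x i * \<sigma> i) * (x j * \<sigma> j)) / N)"
      by (rule sum.swap)
    also have "\<dots> = (\<Sum>\<sigma>\<in>spin_configs N. ising_gibbs J N \<sigma> * (\<Sum>i<N. x i * \<sigma> i)\<^sup>2) / N"
    proof -
      have "(\<Sum>i<N. x i * \<sigma> i)\<^sup>2 = (\<Sum>i<N. \<Sum>j<N. (x i * \<sigma> i) * (x j * \<sigma> j))" for \<sigma>
        unfolding power2_eq_square sum_product ..
      then show ?thesis by (simp only: sum_distrib_left sum_divide_distrib)
    qed
    finally show ?thesis .
  qed
  moreover have "ising_gibbs J N \<sigma> \<ge> 0" for \<sigma> using ising_gibbs_pos[of J N \<sigma>] by simp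
  ultimately show ?thesis
    by (auto simp: psd_mat_def ising_cov_def ising_corr_commute[of J N]
        intro!: eq_matI sum_nonneg divide_nonneg_nonneg mult_nonneg_nonneg)
qed

lemma row_sum_norm_ising_cov_le:
  assumes J: "J \<ge> 0" and N: "N > 0"
  shows "row_sum_norm (ising_cov J N) \<le> 4 / (1 - tanh J) / N"
proof (rule row_sum_norm_le[OF ising_cov_carrier N])
  fix i assume i: "i < N"
  have "(\<Sum>j<N. \<bar>ising_cov J N $$ (i, j)\<bar>) = (\<Sum>j<N. \<bar>ising_corr J N i j\<bar>) / N"
    using i by (simp add: ising_cov_def sum_divide_distrib)
  also have "\<dots> \<le> 4 / (1 - tanh J) / N"
    by (intro divide_right_mono sum_ising_corr_le J i) simp
  finally show "(\<Sum>j<N. \<bar>ising_cov J N $$ (i, j)\<bar>) \<le> 4 / (1 - tanh J) / N" .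
qed

text \<open>
  Replaces the existential quantifier over limit functions by an expression built from countably
  many measurable operations.
\<close>

lemma iterated_limit_iff_lim:
  "iterated_limit a l \<longleftrightarrow> (\<forall>N\<ge>1. convergent (a N)) \<and> (\<lambda>N. lim (a (Suc N))) \<longlonglongrightarrow> l"
proof
  assume "iterated_limit a l"
  then obtain L where L: "\<And>N. N \<ge> 1 \<Longrightarrow> a N \<longlonglongrightarrow> L N" "L \<longlonglongrightarrow> l"
    unfolding iterated_limit_def by auto
  have "lim (a (Suc N)) = L (Suc N)" for N by (rule limI, rule L) simp
  then have "(\<lambda>N. lim (a (Suc N))) \<longlonglongrightarrow> l" using LIMSEQ_Suc[OF L(2)] by simp
  moreover have "convergent (a N)" if "N \<ge> 1" for N using L(1)[OF that] by (rule convergentI)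
  ultimately show "(\<forall>N\<ge>1. convergent (a N)) \<and> (\<lambda>N. lim (a (Suc N))) \<longlonglongrightarrow> l" by simp
next
  assume a: "(\<forall>N\<ge>1. convergent (a N)) \<and> (\<lambda>N. lim (a (Suc N))) \<longlonglongrightarrow> l"
  then have "(\<lambda>N. lim (a N)) \<longlonglongrightarrow> l" by (intro LIMSEQ_imp_Suc[of "\<lambda>N. lim (a N)"]) (rule conjunct2)
  moreover have "a N \<longlonglongrightarrow> lim (a N)" if "N \<ge> 1" for N
    using a that by (simp add: convergent_LIMSEQ_iff)
  ultimately show "iterated_limit a l"
    unfolding iterated_limit_def by (intro exI[of _ "\<lambda>N. lim (a N)"]) simp
qed

lemma iterated_limit_measurable:
  assumes [measurable]: "\<And>N M. (\<lambda>w. a w (Suc N) M) \<in> borel_measurable P"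
  shows "{w \<in> space P. iterated_limit (a w) l} \<in> sets P"
proof -
  have "(\<forall>N\<ge>1. Q N) \<longleftrightarrow> (\<forall>N. Q (Suc N))" for Q :: "nat \<Rightarrow> bool"
  proof (intro iffI allI impI)
    fix N :: nat assume "\<forall>N. Q (Suc N)" "1 \<le> N"
    then show "Q N" by (cases N) auto
  qed auto
  then have eq: "iterated_limit (a w) l \<longleftrightarrow>
      (\<forall>N. Cauchy (\<lambda>M. a w (Suc N) M)) \<and> (\<lambda>N. lim (\<lambda>M. a w (Suc N) M)) \<longlonglongrightarrow> l" for w
    unfolding iterated_limit_iff_lim by (simp add: Cauchy_convergent_iff)
  have [measurable]: "Measurable.pred P (\<lambda>w. Cauchy (\<lambda>M. a w (Suc N) M))" for N
    unfolding pred_def by (rule sets_Collect_Cauchy) (rule assms)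
  have [measurable]: "(\<lambda>w. lim (\<lambda>M. a w (Suc N) M)) \<in> borel_measurable P" for N
    by (rule borel_measurable_lim_metric) (rule assms)
  have [measurable]: "Measurable.pred P (\<lambda>w. (\<lambda>N. lim (\<lambda>M. a w (Suc N) M)) \<longlonglongrightarrow> l)"
    by (rule measurable_limit2) measurable
  show ?thesis unfolding eq by measurable
qed

lemma iterated_limit_0I:
  assumes lim: "\<And>N. N \<ge> 1 \<Longrightarrow> a N \<longlonglongrightarrow> L N"
    and bounds: "\<And>N. N \<ge> 1 \<Longrightarrow> 0 \<le> L N \<and> L N \<le> c / real N"
  shows "iterated_limit a 0"
proof -
  have "L \<longlonglongrightarrow> 0"
  proof (rule Lim_null_comparison)
    show "\<forall>\<^sub>F N in sequentially. norm (L N) \<le> c / real N"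
      using eventually_ge_at_top[of 1] by eventually_elim (use bounds in auto)
    show "(\<lambda>N. c / real N) \<longlonglongrightarrow> 0" by (rule lim_const_over_n)
  qed
  then show ?thesis using lim unfolding iterated_limit_def by blast
qed

lemma iterated_limit_cong:
  assumes "\<And>N M. N \<ge> 1 \<Longrightarrow> a N M = b N M"
  shows "iterated_limit a l \<longleftrightarrow> iterated_limit b l"
proof -
  have "a N = b N" if "N \<ge> 1" for N using assms that by auto
  then show ?thesis by (simp add: iterated_limit_def)
qed

lemma wolff_finite_markov_chain:
  assumes "prob_space P" "wolff_dynamics P J N Y"
  shows "finite_markov_chain P (spin_configs N) (wolff_step J N) Y"
  using assms
  by (simp add: finite_markov_chain_def finite_markov_chain_axioms_def wolff_dynamics_def)

text \<open>
  The first \<open>M\<close> states take only finitely many values, so arbitrary functions of them are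
  measurable; this covers the spectral radius without any regularity argument.
\<close>

lemma wolff_functional_measurable:
  assumes "prob_space P" "wolff_dynamics P J N Y"
  shows "(\<lambda>w. F (sample_cov N M (\<lambda>k. Y k w)) :: real) \<in> borel_measurable P"
proof -
  interpret finite_markov_chain P "spin_configs N" "wolff_step J N" Y
    by (rule wolff_finite_markov_chain[OF assms])
  have "sample_cov N M (\<lambda>k. Y k w) = sample_cov N M (history M w)" for w
    by (auto simp: sample_cov_def history_def)
  then show ?thesis
    using history_fun_measurable[of "\<lambda>s. F (sample_cov N M s)" M] by simp
qed

lemma wolff_sample_cov_tendsto:
  assumes P: "prob_space P" and J: "J \<ge> 0" and N: "N \<ge> 1" and Y: "wolff_dynamics P J N Y"
  shows "AE w in P. (\<lambda>M. row_sum_norm (sample_cov N M (\<lambda>k. Y k w) - ising_cov J N)) \<longlonglongrightarrow> 0"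
proof -
  interpret finite_markov_chain P "spin_configs N" "wolff_step J N" Y
    by (rule wolff_finite_markov_chain[OF P Y])
  have "invariant_on (spin_configs N) (wolff_step J N) (ising_gibbs J N)"
    by (simp add: invariant_on_def ising_gibbs_invariant[OF N J])
  from ergodic_theorem[OF wolff_irreducible[OF J] this ising_gibbs_pos sum_ising_gibbs]
  show ?thesis
  proof (rule AE_mp, intro AE_I2 impI)
    fix w
    assume lim: "\<forall>f. (\<lambda>M. (\<Sum>k=1..M. f (Y k w)) / real M)
        \<longlonglongrightarrow> (\<Sum>\<sigma>\<in>spin_configs N. ising_gibbs J N \<sigma> * f \<sigma>)"
    show "(\<lambda>M. row_sum_norm (sample_cov N M (\<lambda>k. Y k w) - ising_cov J N)) \<longlonglongrightarrow> 0"
    proof (rule row_sum_norm_tendsto_0)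
      fix i j assume ij: "i < N" "j < N"
      have "(\<lambda>M. (\<Sum>k=1..M. Y k w i * Y k w j) / real M / N) \<longlonglongrightarrow> ising_corr J N i j / N"
        unfolding ising_corr_def
        by (intro tendsto_divide lim[rule_format, of "\<lambda>\<sigma>. \<sigma> i * \<sigma> j"] tendsto_const)
          (use N in auto)
      then show "(\<lambda>M. sample_cov N M (\<lambda>k. Y k w) $$ (i, j)) \<longlonglongrightarrow> ising_cov J N $$ (i, j)"
        using ij by (simp add: sample_cov_def ising_cov_def)
    qed (use N in \<open>auto simp: sample_cov_def\<close>)
  qed
qed

lemma tendsto_of_dist_bound:
  fixes f :: "nat \<Rightarrow> real"
  assumes "g \<longlonglongrightarrow> 0" "\<And>n. \<bar>f n - l\<bar> \<le> g n"
  shows "f \<longlonglongrightarrow> l"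
proof -
  have "(\<lambda>n. f n - l) \<longlonglongrightarrow> 0"
    using assms by (intro Lim_null_comparison[OF _ assms(1)]) auto
  then show ?thesis by (simp add: LIM_zero_iff)
qed

theorem theorem4p3:
  fixes P :: "'w measure"
    and J :: real
    and Y :: "nat \<Rightarrow> nat \<Rightarrow> 'w \<Rightarrow> nat \<Rightarrow> real"
  assumes "prob_space P"
    and "J \<ge> 0"
    and "\<And>N. N \<ge> 1 \<Longrightarrow> wolff_dynamics P J N (Y N)"
  defines "K \<equiv> \<lambda>w N M. sample_cov N M (\<lambda>k. Y N k w)"
  shows "measure P {w \<in> space P.
           iterated_limit (\<lambda>N M. real_spectral_radius (K w N M)) 0} = 1
       \<and> measure P {w \<in> space P.
           iterated_limit (\<lambda>N M. row_sum_norm (K w N M)) 0} = 1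
       \<and> (AE w in P. iterated_limit (\<lambda>N M. largest_eigenvalue (K w N M)) 0)"
proof -
  interpret prob_space P by fact
  let ?c = "4 / (1 - tanh J)"
  have K: "psd_mat N (K w N M)" for w N M unfolding K_def by (rule psd_sample_cov)
  then have K_carrier: "K w N M \<in> carrier_mat N N" for w N M by (auto simp: psd_mat_def)
  have "AE w in P. (\<lambda>M. row_sum_norm (K w N M - ising_cov J N)) \<longlonglongrightarrow> 0" if "N \<ge> 1" for N
    unfolding K_def using wolff_sample_cov_tendsto[OF assms(1,2) that assms(3)[OF that]] .
  then have conv: "AE w in P. \<forall>N. N \<ge> 1 \<longrightarrow> (\<lambda>M. row_sum_norm (K w N M - ising_cov J N)) \<longlonglongrightarrow> 0"
    unfolding AE_all_countable by auto
  have norm_bd: "0 \<le> row_sum_norm (ising_cov J N) \<and> row_sum_norm (ising_cov J N) \<le> ?c / N"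
    if "N \<ge> 1" for N
    using that row_sum_norm_ising_cov_le[OF assms(2), of N]
      row_sum_norm_nonneg[OF ising_cov_carrier, of N J] by simp
  have radius_bd: "0 \<le> real_spectral_radius (ising_cov J N)
      \<and> real_spectral_radius (ising_cov J N) \<le> ?c / N" if "N \<ge> 1" for N
    using that norm_bd[OF that] spectral_radius_le_row_sum_norm[OF psd_ising_cov, of N J]
      real_spectral_radius_nonneg[OF ising_cov_carrier, of N J] by linarith
  have radius: "AE w in P. iterated_limit (\<lambda>N M. real_spectral_radius (K w N M)) 0"
    using conv
  proof (rule AE_mp, intro AE_I2 impI)
    fix w assume w: "\<forall>N. N \<ge> 1 \<longrightarrow> (\<lambda>M. row_sum_norm (K w N M - ising_cov J N)) \<longlonglongrightarrow> 0"
    show "iterated_limit (\<lambda>N M. real_spectral_radius (K w N M)) 0"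
    proof (rule iterated_limit_0I[OF _ radius_bd])
      fix N :: nat assume N: "N \<ge> 1"
      show "(\<lambda>M. real_spectral_radius (K w N M)) \<longlonglongrightarrow> real_spectral_radius (ising_cov J N)"
        by (rule tendsto_of_dist_bound[OF w[rule_format, OF N]],
            rule spectral_radius_diff_le[OF K psd_ising_cov]) (use N in simp)
    qed
  qed
  have norm: "AE w in P. iterated_limit (\<lambda>N M. row_sum_norm (K w N M)) 0"
    using conv
  proof (rule AE_mp, intro AE_I2 impI)
    fix w assume w: "\<forall>N. N \<ge> 1 \<longrightarrow> (\<lambda>M. row_sum_norm (K w N M - ising_cov J N)) \<longlonglongrightarrow> 0"
    show "iterated_limit (\<lambda>N M. row_sum_norm (K w N M)) 0"
    proof (rule iterated_limit_0I[OF _ norm_bd])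
      fix N :: nat assume N: "N \<ge> 1"
      show "(\<lambda>M. row_sum_norm (K w N M)) \<longlonglongrightarrow> row_sum_norm (ising_cov J N)"
        by (rule tendsto_of_dist_bound[OF w[rule_format, OF N]],
            rule row_sum_norm_diff_le[OF K_carrier ising_cov_carrier]) (use N in simp)
    qed
  qed
  have meas: "{w \<in> space P. iterated_limit (\<lambda>N M. F (K w N M)) 0} \<in> events"
    for F :: "real mat \<Rightarrow> real"
    unfolding K_def
    by (intro iterated_limit_measurable wolff_functional_measurable[OF assms(1) assms(3)]) simp
  have "iterated_limit (\<lambda>N M. largest_eigenvalue (K w N M)) 0
      \<longleftrightarrow> iterated_limit (\<lambda>N M. real_spectral_radius (K w N M)) 0" for w
    by (rule iterated_limit_cong) (simp add: psd_spectrum(1)[OF K])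
  then show ?thesis
    using radius norm prob_Collect_eq_1[OF meas] by simp
qed

end
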